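(* Let $k\in\{1,2,3,4,5\}$, let $T>0$ and $\Delta t>0$, and let $\tilde\phi^{n+1},\tilde\mu^{n+1},\tilde{\mathbf u}^{n+1},\tilde R^{n+1},\xi^{n+1},\phi^{n+1},\mu^{n+1},\mathbf u^{n+1},p^{n+1},R^{n+1}$ be generated by the $k$-th order scheme (S1)-(S7) described in the context. Given $R^n>0$, one has $\xi^{n+1}>0$ and $$0<R^{n+1}\le R^n,\qquad \forall\, n\le T/\Delta t .$$ Furthermore, the original dissipative law $$E(\phi^{n+1},\mathbf u^{n+1})\le E(\phi^n,\mathbf u^n)$$ holds under the condition $E(\phi^{n+1},\mathbf u^{n+1})+\kappa_0\le R^n$. In addition, there exists a constant $M_T$, independent of $\Delta t$, such that $$\|\mathbf u^{n+1}\|^2+\lambda\|\nabla\phi^{n+1}\|^2+\lambda\gamma\|\phi^{n+1}\|^2\le M_T,\qquad \forall\, n\le T/\Delta t .$$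
   Context: $\Omega\subset\mathbb R^d$ ($d=2,3$) is a bounded domain; $(\cdot,\cdot)$ and $\|\cdot\|$ are the $L^2(\Omega)$ inner product and norm. The constants $M,\lambda,\nu,\epsilon,\gamma>0$ are given. Put $G(\phi)=\frac{1}{4\epsilon^2}(1-\phi^2)^2$, $F(\phi)=G(\phi)-\frac{\gamma}{2}\phi^2$, and $$E(\phi,\mathbf u)=\int_\Omega\Big\{\tfrac12|\mathbf u|^2+\tfrac{\lambda}{2}|\nabla\phi|^2+\tfrac{\lambda\gamma}{2}\phi^2+\lambda F(\phi)\Big\}\,d\mathbf x .$$ The constant $\kappa_0>0$ is chosen so that $\lambda\int_\Omega F(\phi)\,d\mathbf x+\kappa_0>0$ for all $\phi$. The scheme is a time discretization of the Cahn-Hilliard-Navier-Stokes system $\phi_t+(\mathbf u\cdot\nabla)\phi=M\Delta\mu$, $\mu=-\lambda\Delta\phi+\lambda G'(\phi)$, $\mathbf u_t+\mathbf u\cdot\nabla\mathbf u-\nu\Delta\mathbf u+\nabla p=\mu\nabla\phi$, $\nabla\cdot\mathbf u=0$ in $\Omega\times(0,T]$, with boundary conditions $\partial_{\mathbf n}\phi=\partial_{\mathbf n}\mu=0$, $\mathbf u=\mathbf 0$ on $\partial\Omega$. Operators: $\alpha_1=1$, $A_1(f^n)=f^n$, $B_1(g^n)=g^n$; $\alpha_2=\frac32$, $A_2(f^n)=2f^n-\frac12f^{n-1}$, $B_2(g^n)=2g^n-g^{n-1}$; $\alpha_3=\frac{11}{6}$, $A_3(f^n)=3f^n-\frac32f^{n-1}+\frac13f^{n-2}$,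 $B_3(g^n)=3g^n-3g^{n-1}+g^{n-2}$; $\alpha_4=\frac{25}{12}$, $A_4(f^n)=4f^n-3f^{n-1}+\frac43f^{n-2}-\frac14f^{n-3}$, $B_4(g^n)=4g^n-6g^{n-1}+4g^{n-2}-g^{n-3}$; $\alpha_5=\frac{137}{60}$, $A_5(f^n)=5f^n-5f^{n-1}+\frac{10}{3}f^{n-2}-\frac54f^{n-3}+\frac15f^{n-4}$, $B_5(g^n)=5g^n-10g^{n-1}+10g^{n-2}-5g^{n-3}+g^{n-4}$. Scheme of order $k$: given the values at the previous $k$ time levels, find (S1) $\dfrac{\alpha_k\tilde\phi^{n+1}-A_k(\tilde\phi^n)}{\Delta t}+(B_k(\mathbf u^n)\cdot\nabla)B_k(\phi^n)=M\Delta\tilde\mu^{n+1}$, (S2) $\tilde\mu^{n+1}=-\lambda\Delta\tilde\phi^{n+1}+\lambda\gamma\tilde\phi^{n+1}+\lambda F'(B_k(\phi^n))$, (S3) $\dfrac{\alpha_k\tilde{\mathbf u}^{n+1}-A_k(\tilde{\mathbf u}^n)}{\Delta t}-\nu\Delta\tilde{\mathbf u}^{n+1}=B_k(\mu^n)\nabla B_k(\phi^n)-(B_k(\mathbf u^n)\cdot\nabla)B_k(\mathbf u^n)-\nabla B_k(p^n)$, with $\partial_{\mathbf n}\tilde\phi^{n+1}=\partial_{\mathbf n}\tilde\mu^{n+1}=0$, $\tilde{\mathbf u}^{n+1}=\mathbf 0$ on $\partial\Omega$; then (S4) $\dfrac{\tilde R^{n+1}-R^n}{\Delta t}=-\xi^{n+1}\big(M\|\nabla\tilde\mu^{n+1}\|^2+\nu\|\nabla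 B_k(\mathbf u^n)\|^2\big)$, $\quad\xi^{n+1}=\dfrac{\tilde R^{n+1}}{E(\tilde\phi^{n+1},\tilde{\mathbf u}^{n+1})+\kappa_0}$; (S5) $\phi^{n+1}=\eta_k^{n+1}\tilde\phi^{n+1}$, $\mu^{n+1}=\eta_k^{n+1}\tilde\mu^{n+1}$, $\mathbf u^{n+1}=\eta_k^{n+1}\tilde{\mathbf u}^{n+1}$, where $\eta_1^{n+1}=1-(1-\xi^{n+1})^2$ and $\eta_k^{n+1}=1-(1-\xi^{n+1})^k$ for $k=2,3,4,5$; (S6) $(\nabla p^{n+1},\nabla q)=\big(\mu^{n+1}\nabla\phi^{n+1}-(\mathbf u^{n+1}\cdot\nabla)\mathbf u^{n+1}-\nu\nabla\times\nabla\times\tilde{\mathbf u}^{n+1},\nabla q\big)$ for all $q\in H^1(\Omega)$; (S7) $R^{n+1}=\min\{R^n,\;E(\phi^{n+1},\mathbf u^{n+1})+\kappa_0\}$. All functions are assumed regular enough for these expressions to make sense. Initialization: $R^0=E(\phi^0,\mathbf u^0)+\kappa_0$, with $\phi^0,\mathbf u^0$ the given initial data (independent of $\Delta t$). For $k\ge2$ the scheme is used for $n\ge k-1$, with starting values satisfying $0<R^{j+1}\le R^j$ for $0\le j\le k-2$ and $R^j\le E(\phi^j,\mathbf u^j)+\kappa_0$ for $0\le j\le k-1$. *)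

theory Defs
  imports "HOL-Analysis.Analysis"
begin

text \<open>
  Functions on \<open>\<Omega>\<close> are total functions on \<open>real^'d\<close>; only their values almost everywhere on \<open>\<Omega>\<close>
  matter. Derivatives are weak derivatives and equations between functions hold almost everywhere.
\<close>

definition locally_integrable :: "(real^'d) set \<Rightarrow> (real^'d \<Rightarrow> real) \<Rightarrow> bool" where
  "locally_integrable \<Omega> f \<longleftrightarrow> (\<forall>K. compact K \<and> K \<subseteq> \<Omega> \<longrightarrow> integrable (lebesgue_on K) f)"

text \<open>
  Following Gilbarg and Trudinger, first weak derivatives and \<open>H\<^sup>1\<^sub>0\<close> are based on compactly
  supported \<open>C\<^sup>1\<close> functions; smooth test functions give the same notions.
\<close>

definition test_fun :: "(real^'d) set \<Rightarrow> (real^'d \<Rightarrow> real) \<Rightarrow> bool" where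
  "test_fun \<Omega> \<psi> \<longleftrightarrow>
     (\<forall>x. \<psi> differentiable (at x)) \<and>
     (\<forall>i. continuous_on UNIV (\<lambda>x. frechet_derivative \<psi> (at x) (axis i 1))) \<and>
     (\<exists>K. compact K \<and> K \<subseteq> \<Omega> \<and> (\<forall>x. x \<notin> K \<longrightarrow> \<psi> x = 0))"

definition weak_partial ::
    "(real^'d) set \<Rightarrow> 'd \<Rightarrow> (real^'d \<Rightarrow> real) \<Rightarrow> (real^'d \<Rightarrow> real) \<Rightarrow> bool" where
  "weak_partial \<Omega> i f g \<longleftrightarrow>
     locally_integrable \<Omega> f \<and> locally_integrable \<Omega> g \<and>
     (\<forall>\<psi>. test_fun \<Omega> \<psi> \<longrightarrow>
        (LINT x|lebesgue_on \<Omega>. f x * frechet_derivative \<psi> (at x) (axis i 1)) =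
        - (LINT x|lebesgue_on \<Omega>. g x * \<psi> x))"

text \<open>Some representative of the weak derivative, which is unique up to null sets.\<close>

definition pd :: "(real^'d) set \<Rightarrow> 'd \<Rightarrow> (real^'d \<Rightarrow> real) \<Rightarrow> real^'d \<Rightarrow> real" where
  "pd \<Omega> i f = (SOME g. weak_partial \<Omega> i f g)"

definition grad :: "(real^'d) set \<Rightarrow> (real^'d \<Rightarrow> real) \<Rightarrow> real^'d \<Rightarrow> real^'d" where
  "grad \<Omega> f x = (\<chi> i. pd \<Omega> i f x)"

definition vgrad :: "(real^'d) set \<Rightarrow> (real^'d \<Rightarrow> real^'d) \<Rightarrow> real^'d \<Rightarrow> real^'d^'d" where
  "vgrad \<Omega> v x = (\<chi> i j. pd \<Omega> j (\<lambda>y. v y $ i) x)"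

definition laplacian :: "(real^'d) set \<Rightarrow> (real^'d \<Rightarrow> real) \<Rightarrow> real^'d \<Rightarrow> real" where
  "laplacian \<Omega> f x = (\<Sum>i\<in>UNIV. pd \<Omega> i (pd \<Omega> i f) x)"

definition vlaplacian :: "(real^'d) set \<Rightarrow> (real^'d \<Rightarrow> real^'d) \<Rightarrow> real^'d \<Rightarrow> real^'d" where
  "vlaplacian \<Omega> v x = (\<chi> i. laplacian \<Omega> (\<lambda>y. v y $ i) x)"

text \<open>
  With \<open>W i j = \<partial>\<^sub>i v\<^sub>j - \<partial>\<^sub>j v\<^sub>i\<close>, the curl of \<open>v\<close> is \<open>(W 2 3, W 3 1, W 1 2)\<close> for \<open>d = 3\<close> and the
  scalar \<open>W 1 2\<close> for \<open>d = 2\<close> (where the curl of a scalar \<open>w\<close> is \<open>(\<partial>\<^sub>2 w, - \<partial>\<^sub>1 w)\<close>). In both cases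
  component \<open>i\<close> of the curl of the curl is \<open>\<Sum>\<^sub>j \<partial>\<^sub>j (W i j)\<close>.
\<close>

definition curl_curl :: "(real^'d) set \<Rightarrow> (real^'d \<Rightarrow> real^'d) \<Rightarrow> real^'d \<Rightarrow> real^'d" where
  "curl_curl \<Omega> v x =
     (\<chi> i. \<Sum>j\<in>UNIV. pd \<Omega> j (\<lambda>y. pd \<Omega> i (\<lambda>z. v z $ j) y - pd \<Omega> j (\<lambda>z. v z $ i) y) x)"

definition advect :: "(real^'d) set \<Rightarrow> (real^'d \<Rightarrow> real^'d) \<Rightarrow> (real^'d \<Rightarrow> real) \<Rightarrow> real^'d \<Rightarrow> real" where
  "advect \<Omega> v f x = v x \<bullet> grad \<Omega> f x"

definition vadvect :: "(real^'d) set \<Rightarrow> (real^'d \<Rightarrow> real^'d) \<Rightarrow> (real^'d \<Rightarrow> real^'d) \<Rightarrow> real^'d \<Rightarrow> real^'d" where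
  "vadvect \<Omega> v w x = vgrad \<Omega> w x *v v x"

definition L2 :: "(real^'d) set \<Rightarrow> (real^'d \<Rightarrow> 'b::euclidean_space) \<Rightarrow> bool" where
  "L2 \<Omega> f \<longleftrightarrow> f \<in> borel_measurable (lebesgue_on \<Omega>) \<and>
     integrable (lebesgue_on \<Omega>) (\<lambda>x. (norm (f x))\<^sup>2)"

definition l2inner ::
    "(real^'d) set \<Rightarrow> (real^'d \<Rightarrow> 'b::euclidean_space) \<Rightarrow> (real^'d \<Rightarrow> 'b) \<Rightarrow> real" where
  "l2inner \<Omega> f g = (LINT x|lebesgue_on \<Omega>. f x \<bullet> g x)"

text \<open>On matrix-valued functions this uses the Frobenius norm, the norm of \<open>real^'d^'d\<close>.\<close>

definition l2norm :: "(real^'d) set \<Rightarrow> (real^'d \<Rightarrow> 'b::euclidean_space) \<Rightarrow> real" where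
  "l2norm \<Omega> f = sqrt (l2inner \<Omega> f f)"

definition H1 :: "(real^'d) set \<Rightarrow> (real^'d \<Rightarrow> real) \<Rightarrow> bool" where
  "H1 \<Omega> f \<longleftrightarrow> L2 \<Omega> f \<and> (\<forall>i. \<exists>g. weak_partial \<Omega> i f g \<and> L2 \<Omega> g)"

definition H2 :: "(real^'d) set \<Rightarrow> (real^'d \<Rightarrow> real) \<Rightarrow> bool" where
  "H2 \<Omega> f \<longleftrightarrow> H1 \<Omega> f \<and> (\<forall>i. H1 \<Omega> (pd \<Omega> i f))"

definition vH1 :: "(real^'d) set \<Rightarrow> (real^'d \<Rightarrow> real^'d) \<Rightarrow> bool" where
  "vH1 \<Omega> v \<longleftrightarrow> (\<forall>i. H1 \<Omega> (\<lambda>x. v x $ i))"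

definition vH2 :: "(real^'d) set \<Rightarrow> (real^'d \<Rightarrow> real^'d) \<Rightarrow> bool" where
  "vH2 \<Omega> v \<longleftrightarrow> (\<forall>i. H2 \<Omega> (\<lambda>x. v x $ i))"

text \<open>
  Since no smoothness of \<open>\<partial>\<Omega>\<close> is assumed, boundary values are meant in the usual weak sense: a
  function vanishes on \<open>\<partial>\<Omega>\<close> if it lies in \<open>H\<^sup>1\<^sub>0\<close>, and the normal derivative of an \<open>H\<^sup>2\<close> function
  is the functional \<open>q \<mapsto> (\<Delta>f, q) + (\<nabla>f, \<nabla>q)\<close> on \<open>H\<^sup>1\<close>, which is the boundary integral of
  \<open>\<partial>\<^sub>n f q\<close> by Green's formula.
\<close>

definition zero_on_boundary :: "(real^'d) set \<Rightarrow> (real^'d \<Rightarrow> real^'d) \<Rightarrow> bool" where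
  "zero_on_boundary \<Omega> v \<longleftrightarrow> vH1 \<Omega> v \<and>
     (\<exists>\<psi> :: nat \<Rightarrow> real^'d \<Rightarrow> real^'d.
        (\<forall>m i. test_fun \<Omega> (\<lambda>x. \<psi> m x $ i)) \<and>
        (\<lambda>m. (l2norm \<Omega> (\<lambda>x. v x - \<psi> m x))\<^sup>2 + (l2norm \<Omega> (vgrad \<Omega> (\<lambda>x. v x - \<psi> m x)))\<^sup>2)
          \<longlonglongrightarrow> 0)"

definition normal_derivative :: "(real^'d) set \<Rightarrow> (real^'d \<Rightarrow> real) \<Rightarrow> (real^'d \<Rightarrow> real) \<Rightarrow> real" where
  "normal_derivative \<Omega> f q = l2inner \<Omega> (laplacian \<Omega> f) q + l2inner \<Omega> (grad \<Omega> f) (grad \<Omega> q)"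

definition zero_normal_derivative :: "(real^'d) set \<Rightarrow> (real^'d \<Rightarrow> real) \<Rightarrow> bool" where
  "zero_normal_derivative \<Omega> f \<longleftrightarrow> (\<forall>q. H1 \<Omega> q \<longrightarrow> normal_derivative \<Omega> f q = 0)"

definition Gpot :: "real \<Rightarrow> real \<Rightarrow> real" where
  "Gpot \<epsilon> s = 1 / (4 * \<epsilon>\<^sup>2) * (1 - s\<^sup>2)\<^sup>2"

definition Fpot :: "real \<Rightarrow> real \<Rightarrow> real \<Rightarrow> real" where
  "Fpot \<epsilon> \<gamma> s = Gpot \<epsilon> s - \<gamma> / 2 * s\<^sup>2"

definition energy ::
    "(real^'d) set \<Rightarrow> real \<Rightarrow> real \<Rightarrow> real \<Rightarrow> (real^'d \<Rightarrow> real) \<Rightarrow> (real^'d \<Rightarrow> real^'d) \<Rightarrow> real" where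
  "energy \<Omega> lam \<epsilon> \<gamma> \<phi> u =
     (LINT x|lebesgue_on \<Omega>. 1/2 * (norm (u x))\<^sup>2 + lam/2 * (norm (grad \<Omega> \<phi> x))\<^sup>2
        + lam * \<gamma> / 2 * (\<phi> x)\<^sup>2 + lam * Fpot \<epsilon> \<gamma> (\<phi> x))"

definition finite_energy ::
    "(real^'d) set \<Rightarrow> real \<Rightarrow> real \<Rightarrow> (real^'d \<Rightarrow> real) \<Rightarrow> (real^'d \<Rightarrow> real^'d) \<Rightarrow> bool" where
  "finite_energy \<Omega> \<epsilon> \<gamma> \<phi> u \<longleftrightarrow>
     H1 \<Omega> \<phi> \<and> integrable (lebesgue_on \<Omega>) (\<lambda>x. Fpot \<epsilon> \<gamma> (\<phi> x)) \<and> L2 \<Omega> u"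

definition bdf_alpha :: "nat \<Rightarrow> real" where
  "bdf_alpha k = (if k = 1 then 1 else if k = 2 then 3/2 else if k = 3 then 11/6
     else if k = 4 then 25/12 else 137/60)"

text \<open>The operators are only used for \<open>1 \<le> k \<le> 5\<close> and \<open>n \<ge> k - 1\<close>, so no index is truncated.\<close>

definition bdf_A :: "nat \<Rightarrow> (nat \<Rightarrow> 'a \<Rightarrow> 'v::real_vector) \<Rightarrow> nat \<Rightarrow> 'a \<Rightarrow> 'v" where
  "bdf_A k f n x =
    (if k = 1 then f n x
     else if k = 2 then 2 *\<^sub>R f n x - (1/2) *\<^sub>R f (n-1) x
     else if k = 3 then 3 *\<^sub>R f n x - (3/2) *\<^sub>R f (n-1) x + (1/3) *\<^sub>R f (n-2) x
     else if k = 4 then 4 *\<^sub>R f n x - 3 *\<^sub>R f (n-1) x + (4/3) *\<^sub>R f (n-2) x - (1/4) *\<^sub>R f (n-3) x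
     else 5 *\<^sub>R f n x - 5 *\<^sub>R f (n-1) x + (10/3) *\<^sub>R f (n-2) x - (5/4) *\<^sub>R f (n-3) x
            + (1/5) *\<^sub>R f (n-4) x)"

definition bdf_B :: "nat \<Rightarrow> (nat \<Rightarrow> 'a \<Rightarrow> 'v::real_vector) \<Rightarrow> nat \<Rightarrow> 'a \<Rightarrow> 'v" where
  "bdf_B k g n x =
    (if k = 1 then g n x
     else if k = 2 then 2 *\<^sub>R g n x - g (n-1) x
     else if k = 3 then 3 *\<^sub>R g n x - 3 *\<^sub>R g (n-1) x + g (n-2) x
     else if k = 4 then 4 *\<^sub>R g n x - 6 *\<^sub>R g (n-1) x + 4 *\<^sub>R g (n-2) x - g (n-3) x
     else 5 *\<^sub>R g n x - 10 *\<^sub>R g (n-1) x + 10 *\<^sub>R g (n-2) x - 5 *\<^sub>R g (n-3) x + g (n-4) x)"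

definition eta :: "nat \<Rightarrow> real \<Rightarrow> real" where
  "eta k \<xi> = (if k = 1 then 1 - (1 - \<xi>)^2 else 1 - (1 - \<xi>)^k)"

text \<open>
  One step from level \<open>n\<close> to level \<open>n + 1\<close>. The arguments \<open>\<phi>t, \<mu>t, ut, Rt\<close> are the quantities with
  a tilde. The first block is the regularity that gives a meaning to the equations.
\<close>

definition chns_step ::
    "(real^'d) set \<Rightarrow> real \<Rightarrow> real \<Rightarrow> real \<Rightarrow> real \<Rightarrow> real \<Rightarrow> real \<Rightarrow> nat \<Rightarrow> real \<Rightarrow>
     (nat \<Rightarrow> real^'d \<Rightarrow> real) \<Rightarrow> (nat \<Rightarrow> real^'d \<Rightarrow> real) \<Rightarrow> (nat \<Rightarrow> real^'d \<Rightarrow> real^'d) \<Rightarrow> (nat \<Rightarrow> real) \<Rightarrow>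
     (nat \<Rightarrow> real) \<Rightarrow>
     (nat \<Rightarrow> real^'d \<Rightarrow> real) \<Rightarrow> (nat \<Rightarrow> real^'d \<Rightarrow> real) \<Rightarrow> (nat \<Rightarrow> real^'d \<Rightarrow> real^'d) \<Rightarrow>
     (nat \<Rightarrow> real^'d \<Rightarrow> real) \<Rightarrow> (nat \<Rightarrow> real) \<Rightarrow> nat \<Rightarrow> bool" where
  "chns_step \<Omega> M lam \<nu> \<epsilon> \<gamma> \<kappa>0 k dt \<phi>t \<mu>t ut Rt \<xi> \<phi> \<mu> u p R n \<longleftrightarrow>
    (H2 \<Omega> (\<phi>t (n+1)) \<and> H2 \<Omega> (\<mu>t (n+1)) \<and> vH2 \<Omega> (ut (n+1)) \<and> H1 \<Omega> (p (n+1)) \<and>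
     finite_energy \<Omega> \<epsilon> \<gamma> (\<phi>t (n+1)) (ut (n+1)) \<and>
     L2 \<Omega> (\<lambda>x. \<mu> (n+1) x *\<^sub>R grad \<Omega> (\<phi> (n+1)) x - vadvect \<Omega> (u (n+1)) (u (n+1)) x
                - \<nu> *\<^sub>R curl_curl \<Omega> (ut (n+1)) x)) \<and>
    (AE x in lebesgue_on \<Omega>.
       (bdf_alpha k * \<phi>t (n+1) x - bdf_A k \<phi>t n x) / dt + advect \<Omega> (bdf_B k u n) (bdf_B k \<phi> n) x
       = M * laplacian \<Omega> (\<mu>t (n+1)) x) \<and>
    (AE x in lebesgue_on \<Omega>.
       \<mu>t (n+1) x = - lam * laplacian \<Omega> (\<phi>t (n+1)) x + lam * \<gamma> * \<phi>t (n+1) x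
                    + lam * deriv (Fpot \<epsilon> \<gamma>) (bdf_B k \<phi> n x)) \<and>
    (AE x in lebesgue_on \<Omega>.
       (bdf_alpha k *\<^sub>R ut (n+1) x - bdf_A k ut n x) /\<^sub>R dt - \<nu> *\<^sub>R vlaplacian \<Omega> (ut (n+1)) x
       = bdf_B k \<mu> n x *\<^sub>R grad \<Omega> (bdf_B k \<phi> n) x
         - vadvect \<Omega> (bdf_B k u n) (bdf_B k u n) x - grad \<Omega> (bdf_B k p n) x) \<and>
    zero_normal_derivative \<Omega> (\<phi>t (n+1)) \<and> zero_normal_derivative \<Omega> (\<mu>t (n+1)) \<and>
    zero_on_boundary \<Omega> (ut (n+1)) \<and>
    (Rt (n+1) - R n) / dt = - \<xi> (n+1) *
       (M * (l2norm \<Omega> (grad \<Omega> (\<mu>t (n+1))))\<^sup>2 + \<nu> * (l2norm \<Omega> (vgrad \<Omega> (bdf_B k u n)))\<^sup>2) \<and>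
    \<xi> (n+1) = Rt (n+1) / (energy \<Omega> lam \<epsilon> \<gamma> (\<phi>t (n+1)) (ut (n+1)) + \<kappa>0) \<and>
    (AE x in lebesgue_on \<Omega>. \<phi> (n+1) x = eta k (\<xi> (n+1)) * \<phi>t (n+1) x) \<and>
    (AE x in lebesgue_on \<Omega>. \<mu> (n+1) x = eta k (\<xi> (n+1)) * \<mu>t (n+1) x) \<and>
    (AE x in lebesgue_on \<Omega>. u (n+1) x = eta k (\<xi> (n+1)) *\<^sub>R ut (n+1) x) \<and>
    (\<forall>q. H1 \<Omega> q \<longrightarrow>
       l2inner \<Omega> (grad \<Omega> (p (n+1))) (grad \<Omega> q) =
       l2inner \<Omega> (\<lambda>x. \<mu> (n+1) x *\<^sub>R grad \<Omega> (\<phi> (n+1)) x - vadvect \<Omega> (u (n+1)) (u (n+1)) x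
                      - \<nu> *\<^sub>R curl_curl \<Omega> (ut (n+1)) x) (grad \<Omega> q)) \<and>
    R (n+1) = min (R n) (energy \<Omega> lam \<epsilon> \<gamma> (\<phi> (n+1)) (u (n+1)) + \<kappa>0)"

text \<open>
  For \<open>k = 1\<close> the last two conditions add nothing to the initialization of \<open>R 0\<close>.
\<close>

definition chns_start ::
    "(real^'d) set \<Rightarrow> real \<Rightarrow> real \<Rightarrow> real \<Rightarrow> real \<Rightarrow> nat \<Rightarrow>
     (real^'d \<Rightarrow> real) \<Rightarrow> (real^'d \<Rightarrow> real^'d) \<Rightarrow>
     (nat \<Rightarrow> real^'d \<Rightarrow> real) \<Rightarrow> (nat \<Rightarrow> real^'d \<Rightarrow> real^'d) \<Rightarrow>
     (nat \<Rightarrow> real^'d \<Rightarrow> real) \<Rightarrow> (nat \<Rightarrow> real^'d \<Rightarrow> real) \<Rightarrow> (nat \<Rightarrow> real^'d \<Rightarrow> real^'d) \<Rightarrow>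
     (nat \<Rightarrow> real^'d \<Rightarrow> real) \<Rightarrow> (nat \<Rightarrow> real) \<Rightarrow> bool" where
  "chns_start \<Omega> lam \<epsilon> \<gamma> \<kappa>0 k \<phi>0 u0 \<phi>t ut \<phi> \<mu> u p R \<longleftrightarrow>
    \<phi> 0 = \<phi>0 \<and> u 0 = u0 \<and>
    R 0 = energy \<Omega> lam \<epsilon> \<gamma> \<phi>0 u0 + \<kappa>0 \<and>
    (\<forall>j<k. finite_energy \<Omega> \<epsilon> \<gamma> (\<phi> j) (u j) \<and> vH1 \<Omega> (u j) \<and> H1 \<Omega> (p j) \<and>
       L2 \<Omega> (\<mu> j) \<and> L2 \<Omega> (\<phi>t j) \<and> L2 \<Omega> (ut j)) \<and>
    (\<forall>j. j + 1 < k \<longrightarrow> 0 < R (j+1) \<and> R (j+1) \<le> R j) \<and>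
    (\<forall>j<k. R j \<le> energy \<Omega> lam \<epsilon> \<gamma> (\<phi> j) (u j) + \<kappa>0)"

definition chns_scheme ::
    "(real^'d) set \<Rightarrow> real \<Rightarrow> real \<Rightarrow> real \<Rightarrow> real \<Rightarrow> real \<Rightarrow> real \<Rightarrow> nat \<Rightarrow> real \<Rightarrow> real \<Rightarrow>
     (real^'d \<Rightarrow> real) \<Rightarrow> (real^'d \<Rightarrow> real^'d) \<Rightarrow>
     (nat \<Rightarrow> real^'d \<Rightarrow> real) \<Rightarrow> (nat \<Rightarrow> real^'d \<Rightarrow> real) \<Rightarrow> (nat \<Rightarrow> real^'d \<Rightarrow> real^'d) \<Rightarrow> (nat \<Rightarrow> real) \<Rightarrow>
     (nat \<Rightarrow> real) \<Rightarrow>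
     (nat \<Rightarrow> real^'d \<Rightarrow> real) \<Rightarrow> (nat \<Rightarrow> real^'d \<Rightarrow> real) \<Rightarrow> (nat \<Rightarrow> real^'d \<Rightarrow> real^'d) \<Rightarrow>
     (nat \<Rightarrow> real^'d \<Rightarrow> real) \<Rightarrow> (nat \<Rightarrow> real) \<Rightarrow> bool" where
  "chns_scheme \<Omega> M lam \<nu> \<epsilon> \<gamma> \<kappa>0 k T dt \<phi>0 u0 \<phi>t \<mu>t ut Rt \<xi> \<phi> \<mu> u p R \<longleftrightarrow>
    chns_start \<Omega> lam \<epsilon> \<gamma> \<kappa>0 k \<phi>0 u0 \<phi>t ut \<phi> \<mu> u p R \<and>
    (\<forall>n. k - 1 \<le> n \<and> real n \<le> T / dt \<longrightarrow>
       chns_step \<Omega> M lam \<nu> \<epsilon> \<gamma> \<kappa>0 k dt \<phi>t \<mu>t ut Rt \<xi> \<phi> \<mu> u p R n)"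

end

theory Submission
  imports Defs
begin

text \<open>
  Solving (S4) for \<open>\<xi>\<close> shows \<open>\<xi> > 0\<close> and \<open>\<xi> (E(\<phi>t, ut) + \<kappa>\<^sub>0) \<le> R n \<le> R 0\<close>. The quartic \<open>F\<close> attains its
  minimum, so the assumption on \<open>\<kappa>\<^sub>0\<close>, applied to the constant minimizer, bounds \<open>E + \<kappa>\<^sub>0\<close> below by
  some \<open>c > 0\<close> plus half of the quadratic energy. Hence \<open>\<xi> \<le> R 0 / c\<close>. As \<open>\<eta>\<close> is divisible by \<open>\<xi>\<close>,
  \<open>\<eta>\<^sup>2\<close> times the quadratic energy of the intermediate solution is at most a constant times
  \<open>\<xi>\<^sup>2 (E(\<phi>t, ut) + \<kappa>\<^sub>0) \<le> (R 0 / c) R 0\<close>.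

  Since \<open>pd\<close> chooses a representative, identities such as \<open>\<nabla>(\<eta> \<phi>) = \<eta> \<nabla>\<phi>\<close> need the almost everywhere
  uniqueness of weak derivatives, that is, the fundamental lemma of the calculus of variations.
\<close>

subsection \<open>The fundamental lemma of the calculus of variations\<close>

text \<open>Dynkin's argument: open boxes are an intersection-stable generator of the Borel sets,
  and the sets over which \<open>f\<close> integrates to zero are closed under complements and
  countable disjoint unions. The assumption \<open>total\<close> serves the complements, because the
  whole space is not itself a box. A density that vanishes on every Borel set is zero almost
  everywhere.\<close>

lemma integrable_zero_on_boxes_AE_zero_borel:
  fixes f :: "'a::euclidean_space \<Rightarrow> real"
  assumes f: "integrable lborel f" and total: "(LINT x|lborel. f x) = 0"
    and box: "\<And>a b. (LINT x:box a b|lborel. f x) = 0"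
  shows "AE x in lborel. f x = 0"
proof (rule density_unique_real)
  fix A :: "'a set"
  assume "A \<in> sets lborel"
  then have A: "A \<in> sigma_sets UNIV (range (\<lambda>(a, b). box a b))"
    by (simp add: borel_eq_box)
  have "Int_stable (range (\<lambda>(a, b). box a b :: 'a set))"
    by (auto simp: Int_stable_def box_Int_box)
  moreover have "range (\<lambda>(a, b). box a b :: 'a set) \<subseteq> Pow UNIV"
    by simp
  ultimately have "(LINT x:A|lborel. f x) = 0"
    using A
  proof (induction rule: sigma_sets_induct_disjoint)
    case (compl A)
    have A: "A \<in> sets lborel"
      using compl(1) by (simp add: borel_eq_box)
    have "(LINT x:A \<union> (UNIV - A)|lborel. f x) = (LINT x:A|lborel. f x) + (LINT x:UNIV - A|lborel. f x)"
      using A f by (intro set_integral_Un)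
        (auto simp: set_integrable_def intro!: integrable_mult_indicator[where 'b=real, simplified])
    then show ?case
      using compl(2) total by (simp add: set_lebesgue_integral_def)
  next
    case (union A)
    have A: "A i \<in> sets lborel" for i
      using union(2) by (auto simp: borel_eq_box)
    have "(LINT x:(\<Union>i. A i)|lborel. f x) = (\<Sum>i. (LINT x:A i|lborel. f x))"
      using A f union(1) 
      by (intro lebesgue_integral_countable_add)
        (auto simp: set_integrable_def disjoint_family_on_def intro!: integrable_mult_indicator[where 'b=real, simplified])
    with union(3) show ?case
      by simp
  qed (auto simp: box set_lebesgue_integral_def[of _ "{}"])
  then show "(LINT x:A|lborel. f x) = (LINT x:A|lborel. 0)"
    by (simp add: set_lebesgue_integral_def)
qed (use f in auto)

text \<open>A Lebesgue measurable function agrees almost everywhere with a Borel function, whose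
  integrals do not change under completion; this reduces the claim to \<open>lborel\<close>.\<close>

lemma integrable_zero_on_boxes_AE_zero:
  fixes f :: "'a::euclidean_space \<Rightarrow> real"
  assumes f: "integrable lebesgue f" and total: "(LINT x|lebesgue. f x) = 0"
    and box: "\<And>a b. (LINT x:box a b|lebesgue. f x) = 0"
  shows "AE x in lebesgue. f x = 0"
proof -
  obtain g where g[measurable]: "g \<in> borel_measurable lborel" and ae: "AE x in lborel. f x = g x"
    using completion_ex_borel_measurable_real[OF borel_measurable_integrable[OF f]] by blast
  have ae': "AE x in lebesgue. f x = g x"
    using ae by (rule AE_completion)
  have [measurable]: "f \<in> borel_measurable lebesgue" "g \<in> borel_measurable lebesgue"
    using f g by (auto intro: measurable_completion)
  have "integrable lebesgue g"
    using f integrable_cong_AE[of f lebesgue g] ae' by simp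
  then have "integrable lborel g"
    using g by (simp add: integrable_completion)
  moreover have "(LINT x|lborel. g x) = 0"
    using total integral_cong_AE[of f lebesgue g] ae' by (simp add: integral_completion)
  moreover have "(LINT x:box a b|lborel. g x) = 0" for a b
  proof -
    have "(LINT x:box a b|lebesgue. f x) = (LINT x:box a b|lebesgue. g x)"
      unfolding set_lebesgue_integral_def
      using ae'
      by (intro integral_cong_AE)
        (auto intro!: borel_measurable_times borel_measurable_indicator)
    also have "\<dots> = (LINT x:box a b|lborel. g x)"
      unfolding set_lebesgue_integral_def by (intro integral_completion) auto
    finally show ?thesis
      using box by simp
  qed
  ultimately have "AE x in lborel. g x = 0"
    by (rule integrable_zero_on_boxes_AE_zero_borel)
  with ae have "AE x in lborel. f x = 0"
    by eventually_elim simp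
  then show ?thesis
    by (rule AE_completion)
qed

section \<open>Continuously differentiable functions and bumps supported on boxes\<close>

text \<open>The existential over \<open>f'\<close> lets product and chain rule supply the derivative
  explicitly. Continuity along each fixed direction \<open>v\<close> contains the continuity of the
  partial derivatives that \<open>test_fun\<close> demands.\<close>

definition C1_fun :: "('a::real_normed_vector \<Rightarrow> real) \<Rightarrow> bool" where
  "C1_fun f \<longleftrightarrow> (\<exists>f'. (\<forall>x. (f has_derivative f' x) (at x)) \<and> (\<forall>v. continuous_on UNIV (\<lambda>x. f' x v)))"

lemma C1_fun_continuous: "C1_fun f \<Longrightarrow> continuous_on UNIV f"
  unfolding C1_fun_def by (meson continuous_at_imp_continuous_on has_derivative_continuous)

lemma C1_fun_const: "C1_fun (\<lambda>x. c)"
  unfolding C1_fun_def by (intro exI[of _ "\<lambda>x v. 0"]) auto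

lemma C1_fun_mult:
  assumes "C1_fun f" "C1_fun g"
  shows "C1_fun (\<lambda>x. f x * g x)"
proof -
  obtain f' g' where
    "\<And>x. (f has_derivative f' x) (at x)" "\<And>v. continuous_on UNIV (\<lambda>x. f' x v)"
    "\<And>x. (g has_derivative g' x) (at x)" "\<And>v. continuous_on UNIV (\<lambda>x. g' x v)"
    using assms unfolding C1_fun_def by blast
  then show ?thesis
    using C1_fun_continuous[OF assms(1)] C1_fun_continuous[OF assms(2)] unfolding C1_fun_def
    by (intro exI[of _ "\<lambda>x v. f x * g' x v + f' x v * g x"])
      (auto intro!: has_derivative_mult continuous_intros)
qed

lemma C1_fun_prod:
  assumes "finite I" "\<And>i. i \<in> I \<Longrightarrow> C1_fun (f i)"
  shows "C1_fun (\<lambda>x. \<Prod>i\<in>I. f i x)"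
  using assms by (induction rule: finite_induct) (auto intro: C1_fun_const C1_fun_mult)

lemma C1_fun_compose:
  assumes g: "C1_fun g" and h: "\<And>t. (h has_real_derivative h' t) (at t)" "continuous_on UNIV h'"
  shows "C1_fun (\<lambda>x. h (g x))"
proof -
  obtain g' where g': "\<And>x. (g has_derivative g' x) (at x)" "\<And>v. continuous_on UNIV (\<lambda>x. g' x v)"
    using g unfolding C1_fun_def by blast
  have "((\<lambda>x. h (g x)) has_derivative (\<lambda>v. g' x v * h' (g x))) (at x)" for x
    using DERIV_compose_FDERIV[OF h(1) g'(1)] .
  moreover have "continuous_on UNIV (\<lambda>x. g' x v * h' (g x))" for v
    by (intro continuous_intros g' continuous_on_compose2[OF h(2) C1_fun_continuous[OF g]]) auto
  ultimately show ?thesis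
    unfolding C1_fun_def by (intro exI[of _ "\<lambda>x v. g' x v * h' (g x)"]) auto
qed

lemma test_funI:
  assumes "C1_fun \<psi>" "compact K" "K \<subseteq> \<Omega>" "\<And>x. x \<notin> K \<Longrightarrow> \<psi> x = 0"
  shows "test_fun \<Omega> \<psi>"
proof -
  obtain f' where f': "\<And>x. (\<psi> has_derivative f' x) (at x)" "\<And>v. continuous_on UNIV (\<lambda>x. f' x v)"
    using assms(1) unfolding C1_fun_def by blast
  have "frechet_derivative \<psi> (at x) = f' x" for x
    using frechet_derivative_at[OF f'(1)] by simp
  moreover have "\<psi> differentiable (at x)" for x
    using f'(1) unfolding differentiable_def by blast
  ultimately show ?thesis
    using assms(2-4) f'(2) unfolding test_fun_def by auto
qed

text \<open>Squaring removes the kink of the positive part at 0, so powers of this kind can serve as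
  one-sided cutoffs of class \<open>C1_fun\<close>.\<close>

lemma has_real_derivative_pos_part_power2:
  "((\<lambda>t::real. (max 0 t)\<^sup>2) has_real_derivative 2 * max 0 t) (at t)"
proof (cases "t = 0")
  case True
  have "((\<lambda>y::real. max 0 y) \<longlongrightarrow> max 0 0) (at 0)"
    by (intro tendsto_intros)
  \<comment> \<open>The difference quotient at 0 is again the positive part. The equation holds even
    at \<open>y = 0\<close>, where division by zero yields 0.\<close>
  moreover have "\<forall>\<^sub>F y in at 0. max 0 y = (max 0 y)\<^sup>2 / (y::real)"
    by (intro always_eventually) (auto simp: max_def power2_eq_square)
  ultimately have "((\<lambda>y::real. (max 0 y)\<^sup>2 / y) \<longlongrightarrow> 0) (at 0)"
    using tendsto_cong by fastforce
  then show ?thesis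
    using True by (simp add: has_field_derivative_iff)
next
  case False
  consider "t > 0" | "t < 0"
    using False by linarith
  then show ?thesis
  proof cases
    case 1
    have "((\<lambda>t::real. t\<^sup>2) has_real_derivative 2 * t) (at t)"
      by (auto intro!: derivative_eq_intros)
    then have "((\<lambda>t::real. (max 0 t)\<^sup>2) has_real_derivative 2 * t) (at t)"
      by (rule has_field_derivative_transform_within_open[of _ _ _ "{0<..}"]) (use 1 in auto)
    with 1 show ?thesis by simp
  next
    case 2
    have "((\<lambda>t::real. (max 0 t)\<^sup>2) has_real_derivative 0) (at t)"
      by (rule has_field_derivative_transform_within_open[of "\<lambda>_. 0" _ _ "{..<0}"]) (use 2 in auto)
    with 2 show ?thesis by simp
  qed
qed

text \<open>Each coordinate contributes a factor that is positive exactly when the coordinate lies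
  strictly between \<open>a $ i\<close> and \<open>b $ i\<close>; the product is therefore positive
  exactly on the open box.\<close>

lemma box_bump_exists:
  fixes a b :: "real^'d"
  obtains q :: "real^'d \<Rightarrow> real" where "C1_fun q" "\<And>x. x \<in> box a b \<Longrightarrow> q x > 0" "\<And>x. x \<notin> box a b \<Longrightarrow> q x = 0"
proof
  define q :: "real^'d \<Rightarrow> real" where
    "q x = (\<Prod>i\<in>UNIV. (max 0 (x $ i - a $ i))\<^sup>2 * (max 0 (b $ i - x $ i))\<^sup>2)" for x
  have cont: "continuous_on UNIV (\<lambda>t::real. 2 * max 0 t)"
    by (intro continuous_intros)
  have 1: "C1_fun (\<lambda>x::real^'d. x $ i - a $ i)" for i
    unfolding C1_fun_def
    by (intro exI[of _ "\<lambda>x v. v $ i"])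
      (auto intro!: derivative_eq_intros bounded_linear_imp_has_derivative)
  have 2: "C1_fun (\<lambda>x::real^'d. b $ i - x $ i)" for i
    unfolding C1_fun_def
    by (intro exI[of _ "\<lambda>x v. - v $ i"])
      (auto intro!: derivative_eq_intros bounded_linear_imp_has_derivative)
  show "C1_fun q"
    unfolding q_def
    by (intro C1_fun_prod C1_fun_mult C1_fun_compose[OF 1 has_real_derivative_pos_part_power2 cont]
        C1_fun_compose[OF 2 has_real_derivative_pos_part_power2 cont]) auto
  show "q x > 0" if "x \<in> box a b" for x
    using that unfolding q_def 
      by (intro prod_pos ballI mult_pos_pos zero_less_power) (auto simp: mem_box_cart less_max_iff_disj)
  show "q x = 0" if "x \<notin> box a b" for x
  proof -
    obtain i where "x $ i - a $ i \<le> 0 \<or> b $ i - x $ i \<le> 0"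
      using \<open>x \<notin> box a b\<close> by (auto simp: mem_box_cart not_less)
    then have "(max 0 (x $ i - a $ i))\<^sup>2 * (max 0 (b $ i - x $ i))\<^sup>2 = 0"
      by (auto simp: max_absorb1)
    then show ?thesis
      unfolding q_def by (intro prod_zero) auto
  qed
qed

lemma locally_integrable_imp_integrable_indicator:
  assumes g: "locally_integrable \<Omega> g" and K: "compact K" "K \<subseteq> \<Omega>"
  shows "integrable lebesgue (\<lambda>x. indicator K x * g x)"
proof -
  have "K \<inter> space lebesgue \<in> sets lebesgue"
    using K by (simp add: fmeasurableD lmeasurable_compact)
  from integrable_restrict_space[OF this, of g] show ?thesis
    using g K by (simp add: locally_integrable_def del: integrable_mult_indicator integrable_real_mult_indicator)
qed

text \<open>With a \<open>C\<^sup>1\<close> function \<open>q\<close> positive exactly on the box, \<open>1 - exp (- m q)\<close> tends to its indicator.\<close>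

lemma fundamental_lemma_box:
  fixes g :: "real^'d \<Rightarrow> real"
  assumes g: "locally_integrable \<Omega> g" and \<Omega>: "open \<Omega>" and K: "cbox a b \<subseteq> \<Omega>"
    and zero: "\<And>\<psi>. test_fun \<Omega> \<psi> \<Longrightarrow> (LINT x|lebesgue_on \<Omega>. g x * \<psi> x) = 0"
  shows "(LINT x:box a b|lebesgue. g x) = 0"
proof -
  obtain q where q: "C1_fun q" "\<And>x. x \<in> box a b \<Longrightarrow> q x > 0" "\<And>x. x \<notin> box a b \<Longrightarrow> q x = 0"
    using box_bump_exists[of a b] by blast
  define \<psi> where "\<psi> m x = 1 - exp (- (real m * q x))" for m x
  have q_nonneg: "q x \<ge> 0" for x
    using q(2,3)[of x] by (cases "x \<in> box a b") auto
  have C1: "C1_fun (\<psi> m)" for m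
    unfolding \<psi>_def
    by (rule C1_fun_compose[OF q(1), where h="\<lambda>t. 1 - exp (- (real m * t))" and h'="\<lambda>t. real m * exp (- (real m * t))"])
      (auto intro!: derivative_eq_intros continuous_intros)
  have test: "test_fun \<Omega> (\<psi> m)" for m
    by (rule test_funI[OF C1 compact_cbox K]) (use q(3) box_subset_cbox in \<open>auto simp: \<psi>_def\<close>)
  have gK: "integrable lebesgue (\<lambda>x. indicator (cbox a b) x * g x)"
    using g compact_cbox K by (rule locally_integrable_imp_integrable_indicator)
  have [measurable]: "\<psi> m \<in> borel_measurable lebesgue" for m
    using C1_fun_continuous[OF C1[of m]]
    by (intro measurable_completion) (simp add: borel_measurable_continuous_onI)
  have eq: "(LINT x|lebesgue. indicator (cbox a b) x * g x * \<psi> m x) = 0" for m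
  proof -
    have "(LINT x|lebesgue_on \<Omega>. g x * \<psi> m x) = (LINT x|lebesgue. indicator \<Omega> x * (g x * \<psi> m x))"
      using integral_restrict_space[of \<Omega> lebesgue "\<lambda>x. g x * \<psi> m x"] \<Omega> by simp
    also have "\<dots> = (LINT x|lebesgue. indicator (cbox a b) x * g x * \<psi> m x)"
      using K q(3) box_subset_cbox[of a b] by (intro Bochner_Integration.integral_cong) (auto simp: indicator_def \<psi>_def)
    finally show ?thesis
      using zero[OF test] by simp
  qed
  have "(\<lambda>m. (LINT x|lebesgue. indicator (cbox a b) x * g x * \<psi> m x)) \<longlonglongrightarrow> (LINT x|lebesgue. indicator (box a b) x * g x)"
  proof (rule integral_dominated_convergence)
    \<comment> \<open>Measurability of \<open>g\<close> is available only after restriction to a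
      compact subset of \<open>\<Omega>\<close>, so the limit is rewritten to pass through the
      closed box.\<close>
    have "(\<lambda>x. indicator (box a b) x * (indicator (cbox a b) x * g x)) = (\<lambda>x. indicator (box a b) x * g x)"
      using box_subset_cbox[of a b] by (auto simp: fun_eq_iff indicator_def)
    moreover have "(\<lambda>x. indicator (box a b) x * (indicator (cbox a b) x * g x)) \<in> borel_measurable lebesgue"
      by (intro borel_measurable_times[OF borel_measurable_indicator borel_measurable_integrable[OF gK]]) simp
    ultimately show "(\<lambda>x. indicator (box a b) x * g x) \<in> borel_measurable lebesgue"
      by (simp only:)
    show "(\<lambda>x. indicator (cbox a b) x * g x * \<psi> m x) \<in> borel_measurable lebesgue" for m
      by (intro borel_measurable_times[OF borel_measurable_integrable[OF gK]]) simp
    show "integrable lebesgue (\<lambda>x. norm (indicator (cbox a b) x * g x))"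
      using gK by (rule integrable_norm)
    have "0 \<le> \<psi> m x" "\<psi> m x \<le> 1" for m x
      using q_nonneg[of x] by (auto simp: \<psi>_def)
    then show "AE x in lebesgue. norm (indicator (cbox a b) x * g x * \<psi> m x) \<le> norm (indicator (cbox a b) x * g x)" for m
      by (intro always_eventually allI) (simp add: abs_mult mult_left_le)
    have "(\<lambda>m. indicator (cbox a b) x * g x * \<psi> m x) \<longlonglongrightarrow> indicator (box a b) x * g x" for x
    proof (cases "x \<in> box a b")
      case True
      \<comment> \<open>Inside the box \<open>exp (- m q)\<close> is a geometric sequence with ratio
        \<open>exp (- q x) < 1\<close>.\<close>
      have "(\<lambda>m. exp (- q x) ^ m) \<longlonglongrightarrow> 0"
        using q(2)[OF True] by (simp add: LIMSEQ_realpow_zero)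
      then have "(\<lambda>m. g x * (1 - exp (- q x) ^ m)) \<longlonglongrightarrow> g x * (1 - 0)"
        by (intro tendsto_mult tendsto_diff tendsto_const)
      then show ?thesis
        using True box_subset_cbox[of a b] by (auto simp: \<psi>_def exp_of_nat_mult[symmetric])
    next
      case False
      then show ?thesis
        using q(3) by (simp add: \<psi>_def)
    qed
    then show "AE x in lebesgue. (\<lambda>m. indicator (cbox a b) x * g x * \<psi> m x) \<longlonglongrightarrow> indicator (box a b) x * g x"
      by (intro always_eventually allI)
  qed
  then show ?thesis
    using eq by (simp add: set_lebesgue_integral_def LIMSEQ_const_iff)
qed

text \<open>On a closed box inside \<open>\<Omega>\<close> the integrals of \<open>g\<close> over
  all open subboxes vanish, so \<open>g\<close> is zero almost everywhere there. Countably many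
  closed boxes exhaust an open set, so the exceptional null sets can be united.\<close>

lemma fundamental_lemma_calculus_of_variations:
  fixes g :: "real^'d \<Rightarrow> real"
  assumes g: "locally_integrable \<Omega> g" and \<Omega>: "open \<Omega>"
    and zero: "\<And>\<psi>. test_fun \<Omega> \<psi> \<Longrightarrow> (LINT x|lebesgue_on \<Omega>. g x * \<psi> x) = 0"
  shows "AE x in lebesgue_on \<Omega>. g x = 0"
proof -
  have cbox: "AE x in lebesgue. x \<in> cbox a b \<longrightarrow> g x = 0" if K: "cbox a b \<subseteq> \<Omega>" for a b
  proof -
    let ?f = "\<lambda>x. indicator (box a b) x * g x"
    have "integrable lebesgue (\<lambda>x. indicator (cbox a b) x * g x)"
      using g compact_cbox K by (rule locally_integrable_imp_integrable_indicator)
    then have "integrable lebesgue (\<lambda>x. indicator (box a b) x * (indicator (cbox a b) x * g x))"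
      by (rule integrable_mult_indicator[where 'b=real, unfolded real_scaleR_def, rotated]) simp
    moreover have "(\<lambda>x. indicator (box a b) x * (indicator (cbox a b) x * g x)) = ?f"
      using box_subset_cbox[of a b] by (auto simp: fun_eq_iff indicator_def)
    ultimately have "integrable lebesgue ?f"
      by (simp only:)
    moreover have "(LINT x|lebesgue. ?f x) = 0"
      using fundamental_lemma_box[OF g \<Omega> K zero] by (simp add: set_lebesgue_integral_def)
    \<comment> \<open>Cutting \<open>g\<close> off outside \<open>box a b\<close> makes it
      integrable on the whole space; since boxes intersect in boxes, testing on an arbitrary box
      only sees subboxes of \<open>box a b\<close>.\<close>
    moreover have "(LINT x:box c d|lebesgue. ?f x) = 0" for c d
    proof -
      obtain a' b' where ab': "box c d \<inter> box a b = box a' b'"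
        unfolding box_Int_box by blast
      have "(LINT x:box c d|lebesgue. ?f x) = (LINT x:box a' b'|lebesgue. g x)"
        unfolding set_lebesgue_integral_def ab'[symmetric]
        by (intro Bochner_Integration.integral_cong) (auto simp: indicator_def)
      also have "\<dots> = 0"
      proof (cases "box a' b' = {}")
        \<comment> \<open>Nonemptiness matters: only then is \<open>cbox a' b'\<close> the closure
          of \<open>box a' b'\<close>, and hence contained in \<open>cbox a b\<close>.\<close>
        case False
        then have "cbox a' b' \<subseteq> cbox a b"
          using ab' box_subset_cbox[of a b] closure_minimal[of "box a' b'" "cbox a b"]
          by (auto simp: closure_box)
        with K fundamental_lemma_box[OF g \<Omega> _ zero] show ?thesis
          by blast
      qed (simp add: set_lebesgue_integral_def)
      finally show ?thesis .
    qed
    ultimately have "AE x in lebesgue. ?f x = 0"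
      by (rule integrable_zero_on_boxes_AE_zero)
    \<comment> \<open>The cutoff gives information on the open box only; the faces form a null
      set.\<close>
    moreover have "AE x in lebesgue. x \<notin> cbox a b - box a b"
      by (rule AE_not_in) (simp add: negligible_iff_null_sets[symmetric] negligible_frontier_interval)
    ultimately show ?thesis
      by eventually_elim (auto simp: indicator_def)
  qed
  obtain D where D: "countable D" "D \<subseteq> Pow \<Omega>" "\<And>X. X \<in> D \<Longrightarrow> \<exists>a b. X = cbox a b" "\<Union>D = \<Omega>"
    using open_countable_Union_open_cbox[OF \<Omega>] by metis
  have "AE x in lebesgue. x \<in> X \<longrightarrow> g x = 0" if "X \<in> D" for X
    using cbox D(2,3) that by blast
  then have "AE x in lebesgue. \<forall>X\<in>D. x \<in> X \<longrightarrow> g x = 0"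
    using D(1) by (subst AE_ball_countable) auto
  then have "AE x in lebesgue. x \<in> \<Omega> \<longrightarrow> g x = 0"
    by eventually_elim (use D(4) in blast)
  then show ?thesis
    using \<Omega> by (subst AE_restrict_space_iff) auto
qed

subsection \<open>Weak derivatives up to null sets\<close>

text \<open>Completeness of Lebesgue measure carries measurability over to an almost everywhere
  equal function, after extension by zero to the whole space.\<close>

lemma borel_measurable_lebesgue_on_AE:
  fixes f g :: "'a::euclidean_space \<Rightarrow> 'b::euclidean_space"
  assumes S: "S \<in> sets lebesgue" and f: "f \<in> borel_measurable (lebesgue_on S)"
    and ae: "AE x in lebesgue_on S. f x = g x"
  shows "g \<in> borel_measurable (lebesgue_on S)"
proof -
  have S': "S \<inter> space lebesgue \<in> sets lebesgue"
    using S by simp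
  have "AE x in lebesgue. indicator S x *\<^sub>R f x = indicator S x *\<^sub>R g x"
    using ae unfolding AE_restrict_space_iff[OF S'] by eventually_elim (auto simp: indicator_def)
  moreover have "(\<lambda>x. indicator S x *\<^sub>R f x) \<in> borel_measurable lebesgue"
    using f unfolding borel_measurable_restrict_space_iff[OF S'] by simp
  ultimately have "(\<lambda>x. indicator S x *\<^sub>R g x) \<in> borel_measurable lebesgue"
    by (rule borel_measurable_AE[rotated])
  then show ?thesis
    unfolding borel_measurable_restrict_space_iff[OF S'] by simp
qed

lemma integrable_lebesgue_on_cong_AE:
  fixes f g :: "'a::euclidean_space \<Rightarrow> 'b::euclidean_space"
  assumes S: "S \<in> sets lebesgue" and f: "integrable (lebesgue_on S) f"
    and ae: "AE x in lebesgue_on S. f x = g x"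
  shows "integrable (lebesgue_on S) g"
  using integrable_cong_AE[OF borel_measurable_integrable[OF f]
      borel_measurable_lebesgue_on_AE[OF S borel_measurable_integrable[OF f] ae] ae] f by simp

text \<open>No integrability is assumed: if one function fails to be integrable, so does the other,
  and both integrals have the default value 0.\<close>

lemma integral_lebesgue_on_cong_AE:
  fixes f g :: "'a::euclidean_space \<Rightarrow> 'b::euclidean_space"
  assumes S: "S \<in> sets lebesgue" and ae: "AE x in lebesgue_on S. f x = g x"
  shows "(LINT x|lebesgue_on S. f x) = (LINT x|lebesgue_on S. g x)"
proof (cases "integrable (lebesgue_on S) f")
  case True
  then show ?thesis
    using borel_measurable_lebesgue_on_AE[OF S borel_measurable_integrable[OF True] ae] ae
    by (intro integral_cong_AE) auto
next
  case False
  have "AE x in lebesgue_on S. g x = f x"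
    using ae by eventually_elim simp
  with False have "\<not> integrable (lebesgue_on S) g"
    using integrable_lebesgue_on_cong_AE[OF S] by blast
  with False show ?thesis
    by (simp add: not_integrable_integral_eq)
qed

lemma AE_lebesgue_on_subset:
  assumes "AE x in lebesgue_on T. P x" "S \<subseteq> T" "S \<in> sets lebesgue" "T \<in> sets lebesgue"
  shows "AE x in lebesgue_on S. P x"
proof -
  have "AE x in lebesgue. x \<in> T \<longrightarrow> P x"
    using assms AE_restrict_space_iff[of T lebesgue P] by simp
  then have "AE x in lebesgue. x \<in> S \<longrightarrow> P x"
    by eventually_elim (use assms(2) in auto)
  then show ?thesis
    using assms AE_restrict_space_iff[of S lebesgue P] by simp
qed

text \<open>A test function is bounded and lives on a compact \<open>K\<close>, so the product is
  dominated by a multiple of \<open>g\<close> cut off outside \<open>K\<close>.\<close>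

lemma locally_integrable_mult_test_fun:
  assumes g: "locally_integrable \<Omega> g" and \<psi>: "test_fun \<Omega> \<psi>" and \<Omega>: "open \<Omega>"
  shows "integrable (lebesgue_on \<Omega>) (\<lambda>x. g x * \<psi> x)"
proof -
  obtain K where K: "compact K" "K \<subseteq> \<Omega>" "\<And>x. x \<notin> K \<Longrightarrow> \<psi> x = 0"
    using \<psi> unfolding test_fun_def by blast
  have cont: "continuous_on UNIV \<psi>"
    using \<psi> unfolding test_fun_def by (simp add: continuous_at_imp_continuous_on differentiable_imp_continuous_within)
  then have "bounded (\<psi> ` K)"
    using K(1) by (meson compact_continuous_image compact_imp_bounded continuous_on_subset subset_UNIV)
  then obtain B where B: "\<And>x. x \<in> K \<Longrightarrow> \<bar>\<psi> x\<bar> \<le> B" "B > 0"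
    unfolding bounded_pos by auto
  have bound: "\<bar>\<psi> x\<bar> \<le> B" for x
    using B K(3)[of x] by (cases "x \<in> K") auto
  have gK: "integrable lebesgue (\<lambda>x. indicator K x * g x)"
    by (rule locally_integrable_imp_integrable_indicator[OF g K(1,2)])
  have \<psi>_meas: "\<psi> \<in> borel_measurable lebesgue"
    using cont by (intro measurable_completion) (simp add: borel_measurable_continuous_onI)
  have "integrable lebesgue (\<lambda>x. (indicator K x * g x) * \<psi> x)"
  proof (rule Bochner_Integration.integrable_bound)
    show "integrable lebesgue (\<lambda>x. B * (indicator K x * g x))"
      using gK by (rule integrable_mult_right)
    show "(\<lambda>x. (indicator K x * g x) * \<psi> x) \<in> borel_measurable lebesgue"
      by (rule borel_measurable_times[OF borel_measurable_integrable[OF gK] \<psi>_meas])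
    show "AE x in lebesgue. norm (indicator K x * g x * \<psi> x) \<le> norm (B * (indicator K x * g x))"
    proof (intro always_eventually allI)
      fix x
      have "\<bar>indicator K x * g x\<bar> * \<bar>\<psi> x\<bar> \<le> \<bar>indicator K x * g x\<bar> * B"
        by (intro mult_left_mono bound) simp
      then show "norm (indicator K x * g x * \<psi> x) \<le> norm (B * (indicator K x * g x))"
        using B(2) by (simp add: abs_mult mult_ac)
    qed
  qed
  moreover have "indicator K x * g x * \<psi> x = indicator \<Omega> x *\<^sub>R (g x * \<psi> x)" for x
    using K(2,3) by (cases "x \<in> K") (auto simp: indicator_def)
  ultimately show ?thesis
    using integrable_restrict_space[of \<Omega> lebesgue "\<lambda>x. g x * \<psi> x"] \<Omega> by simp
qed

text \<open>The difference of two weak derivatives annihilates every test function. Integrability of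
  both products is what allows the two integrals to be merged into one.\<close>

lemma weak_partial_unique:
  assumes \<Omega>: "open \<Omega>" and g: "weak_partial \<Omega> i f g" and h: "weak_partial \<Omega> i f h"
  shows "AE x in lebesgue_on \<Omega>. g x = h x"
proof -
  have loc: "locally_integrable \<Omega> g" "locally_integrable \<Omega> h"
    using g h unfolding weak_partial_def by auto
  have "AE x in lebesgue_on \<Omega>. g x - h x = 0"
  proof (rule fundamental_lemma_calculus_of_variations[OF _ \<Omega>])
    show "locally_integrable \<Omega> (\<lambda>x. g x - h x)"
      using loc by (simp add: locally_integrable_def)
    fix \<psi> assume \<psi>: "test_fun \<Omega> \<psi>"
    have "(LINT x|lebesgue_on \<Omega>. g x * \<psi> x) = (LINT x|lebesgue_on \<Omega>. h x * \<psi> x)"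
      using g h \<psi> by (simp add: weak_partial_def)
    moreover have "integrable (lebesgue_on \<Omega>) (\<lambda>x. g x * \<psi> x)" "integrable (lebesgue_on \<Omega>) (\<lambda>x. h x * \<psi> x)"
      using loc locally_integrable_mult_test_fun[OF _ \<psi> \<Omega>] by blast+
    ultimately have "(LINT x|lebesgue_on \<Omega>. g x * \<psi> x - h x * \<psi> x) = 0"
      by (subst Bochner_Integration.integral_diff) simp_all
    then show "(LINT x|lebesgue_on \<Omega>. (g x - h x) * \<psi> x) = 0"
      unfolding left_diff_distrib .
  qed
  then show ?thesis
    by simp
qed

text \<open>Scaling and almost everywhere modification are treated together, because (S5) determines
  the new functions only as almost everywhere multiples of the intermediate ones.\<close>

lemma weak_partial_scale_cong_AE:
  assumes \<Omega>: "open \<Omega>" and g: "weak_partial \<Omega> i f g" 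
    and ae: "AE x in lebesgue_on \<Omega>. f' x = c * f x"
  shows "weak_partial \<Omega> i f' (\<lambda>x. c * g x)"
proof -
  have \<Omega>': "\<Omega> \<in> sets lebesgue"
    using \<Omega> by simp
  have ae': "AE x in lebesgue_on \<Omega>. c * f x = f' x"
    using ae by eventually_elim simp
  have "integrable (lebesgue_on K) f'" if K: "compact K" "K \<subseteq> \<Omega>" for K
  proof -
    have "K \<in> sets lebesgue"
      using K by (simp add: fmeasurableD lmeasurable_compact)
    moreover have "integrable (lebesgue_on K) (\<lambda>x. c * f x)"
      using g K unfolding weak_partial_def locally_integrable_def by simp
    ultimately show ?thesis
      using AE_lebesgue_on_subset[OF ae' K(2) _ \<Omega>']
      by (intro integrable_lebesgue_on_cong_AE[of K "\<lambda>x. c * f x" f']) auto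
  qed
  moreover have "(LINT x|lebesgue_on \<Omega>. f' x * frechet_derivative \<psi> (at x) (axis i 1)) =
      - (LINT x|lebesgue_on \<Omega>. c * g x * \<psi> x)" if "test_fun \<Omega> \<psi>" for \<psi>
  proof -
    have "(LINT x|lebesgue_on \<Omega>. f' x * frechet_derivative \<psi> (at x) (axis i 1)) =
        (LINT x|lebesgue_on \<Omega>. c * (f x * frechet_derivative \<psi> (at x) (axis i 1)))"
      by (rule integral_lebesgue_on_cong_AE[OF \<Omega>']) (use ae in eventually_elim, simp)
    also have "\<dots> = - (LINT x|lebesgue_on \<Omega>. c * (g x * \<psi> x))"
      using g that unfolding weak_partial_def by simp
    finally show ?thesis
      by (simp add: mult.assoc)
  qed
  ultimately show ?thesis
    using g by (simp add: weak_partial_def locally_integrable_def)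
qed

lemma L2_scale_cong_AE:
  fixes f f' :: "real^'d \<Rightarrow> 'b::euclidean_space"
  assumes \<Omega>: "open \<Omega>" and f: "L2 \<Omega> f" and ae: "AE x in lebesgue_on \<Omega>. f' x = c *\<^sub>R f x"
  shows "L2 \<Omega> f'"
  unfolding L2_def
proof
  have \<Omega>': "\<Omega> \<in> sets lebesgue"
    using \<Omega> by simp
  have "(\<lambda>x. c *\<^sub>R f x) \<in> borel_measurable (lebesgue_on \<Omega>)"
    using f by (intro borel_measurable_scaleR) (auto simp: L2_def)
  then show "f' \<in> borel_measurable (lebesgue_on \<Omega>)"
    by (rule borel_measurable_lebesgue_on_AE[OF \<Omega>']) (use ae in eventually_elim, simp)
  have "integrable (lebesgue_on \<Omega>) (\<lambda>x. c\<^sup>2 * (norm (f x))\<^sup>2)"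
    using f unfolding L2_def by simp
  then show "integrable (lebesgue_on \<Omega>) (\<lambda>x. (norm (f' x))\<^sup>2)"
    by (rule integrable_lebesgue_on_cong_AE[OF \<Omega>'])
      (use ae in eventually_elim, simp add: power_mult_distrib)
qed

lemma weak_partial_pd:
  assumes "weak_partial \<Omega> i f g"
  shows "weak_partial \<Omega> i f (pd \<Omega> i f)"
  using assms unfolding pd_def by (rule someI[of "weak_partial \<Omega> i f"])

lemma H1_imp_L2: "H1 \<Omega> f \<Longrightarrow> L2 \<Omega> f"
  by (simp add: H1_def)

text \<open>\<open>H1\<close> provides some square integrable weak derivative, while
  \<open>pd\<close> may choose another one; uniqueness up to null sets transfers square
  integrability to the chosen one.\<close>

lemma H1_pd:
  assumes \<Omega>: "open \<Omega>" and f: "H1 \<Omega> f"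
  shows "weak_partial \<Omega> i f (pd \<Omega> i f)" "L2 \<Omega> (pd \<Omega> i f)"
proof -
  obtain g where g: "weak_partial \<Omega> i f g" "L2 \<Omega> g"
    using f unfolding H1_def by blast
  show wp: "weak_partial \<Omega> i f (pd \<Omega> i f)"
    using weak_partial_pd[OF g(1)] .
  show "L2 \<Omega> (pd \<Omega> i f)"
    using weak_partial_unique[OF \<Omega> wp g(1)] by (intro L2_scale_cong_AE[OF \<Omega> g(2), of _ 1]) simp
qed

lemma H1_scale_cong_AE:
  assumes \<Omega>: "open \<Omega>" and f: "H1 \<Omega> f" and ae: "AE x in lebesgue_on \<Omega>. f' x = c * f x"
  shows "H1 \<Omega> f'"
  unfolding H1_def
proof (intro conjI allI)
  show "L2 \<Omega> f'"
    using ae by (intro L2_scale_cong_AE[OF \<Omega> H1_imp_L2[OF f], of _ c]) simp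
  show "\<exists>g. weak_partial \<Omega> i f' g \<and> L2 \<Omega> g" for i
    by (intro exI[of _ "\<lambda>x. c * pd \<Omega> i f x"] conjI weak_partial_scale_cong_AE[OF \<Omega> H1_pd(1)[OF \<Omega> f] ae]
        L2_scale_cong_AE[OF \<Omega> H1_pd(2)[OF \<Omega> f, of i], where c=c]) simp
qed

text \<open>Both \<open>pd \<Omega> i f'\<close> and \<open>c\<close> times
  \<open>pd \<Omega> i f\<close> are weak derivatives of \<open>f'\<close>, so they agree almost
  everywhere; finitely many coordinates give one common null set.\<close>

lemma grad_scale_cong_AE:
  assumes \<Omega>: "open \<Omega>" and f: "H1 \<Omega> f" and ae: "AE x in lebesgue_on \<Omega>. f' x = c * f x"
  shows "AE x in lebesgue_on \<Omega>. grad \<Omega> f' x = c *\<^sub>R grad \<Omega> f x"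
proof -
  have "AE x in lebesgue_on \<Omega>. pd \<Omega> i f' x = c * pd \<Omega> i f x" for i
    using weak_partial_unique[OF \<Omega> H1_pd(1)[OF \<Omega> H1_scale_cong_AE[OF \<Omega> f ae]]
      weak_partial_scale_cong_AE[OF \<Omega> H1_pd(1)[OF \<Omega> f] ae]] .
  then have "AE x in lebesgue_on \<Omega>. \<forall>i\<in>UNIV. pd \<Omega> i f' x = c * pd \<Omega> i f x"
    by (intro AE_finite_allI) auto
  then show ?thesis
    by eventually_elim (simp add: grad_def vec_eq_iff)
qed

lemma H1_grad_integrable:
  assumes \<Omega>: "open \<Omega>" and f: "H1 \<Omega> f"
  shows "integrable (lebesgue_on \<Omega>) (\<lambda>x. (norm (grad \<Omega> f x))\<^sup>2)"
proof -
  have "(norm (grad \<Omega> f x))\<^sup>2 = (\<Sum>i\<in>UNIV. (norm (pd \<Omega> i f x))\<^sup>2)" for x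
    unfolding power2_norm_eq_inner by (simp add: inner_vec_def grad_def)
  then show ?thesis
    using H1_pd(2)[OF \<Omega> f] unfolding L2_def by simp
qed

lemma l2norm_power2: "(l2norm \<Omega> f)\<^sup>2 = (LINT x|lebesgue_on \<Omega>. (norm (f x))\<^sup>2)"
  unfolding l2norm_def l2inner_def power2_norm_eq_inner by (simp add: integral_nonneg_AE)

lemma l2norm_scale_cong_AE:
  assumes "open \<Omega>" "AE x in lebesgue_on \<Omega>. f' x = c *\<^sub>R f x"
  shows "(l2norm \<Omega> f')\<^sup>2 = c\<^sup>2 * (l2norm \<Omega> f)\<^sup>2"
proof -
  have "(LINT x|lebesgue_on \<Omega>. (norm (f' x))\<^sup>2) = (LINT x|lebesgue_on \<Omega>. c\<^sup>2 * (norm (f x))\<^sup>2)"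
    using assms(1) by (intro integral_lebesgue_on_cong_AE)
      (simp, use assms(2) in eventually_elim, simp add: power_mult_distrib)
  then show ?thesis
    by (simp add: l2norm_power2)
qed

subsection \<open>Coercivity of the energy\<close>

text \<open>\<open>Fpot\<close> is a quadratic polynomial in \<open>s\<^sup>2\<close> with vertex at
  \<open>1 + \<gamma> * \<epsilon>\<^sup>2\<close>; completing the square exhibits the global
  minimizer.\<close>

lemma Fpot_complete_square:
  assumes "\<epsilon> > 0" "\<gamma> > 0"
  shows "Fpot \<epsilon> \<gamma> s = Fpot \<epsilon> \<gamma> (sqrt (1 + \<gamma> * \<epsilon>\<^sup>2)) + (s\<^sup>2 - (1 + \<gamma> * \<epsilon>\<^sup>2))\<^sup>2 / (4 * \<epsilon>\<^sup>2)"
proof -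
  have "(sqrt (1 + \<gamma> * \<epsilon>\<^sup>2))\<^sup>2 = 1 + \<gamma> * \<epsilon>\<^sup>2"
    using assms by (intro real_sqrt_pow2) (simp add: add_nonneg_nonneg)
  then show ?thesis
    using assms unfolding Fpot_def Gpot_def
    by (simp add: field_simps) (simp add: algebra_simps power2_eq_square power4_eq_xxxx)
qed

lemma Fpot_expand:
  assumes "\<epsilon> > 0"
  shows "Fpot \<epsilon> \<gamma> s = 1 / (4 * \<epsilon>\<^sup>2) - (1 / (2 * \<epsilon>\<^sup>2) + \<gamma> / 2) * s\<^sup>2 + 1 / (4 * \<epsilon>\<^sup>2) * s ^ 4"
  using assms unfolding Fpot_def Gpot_def
  by (simp add: field_simps) (simp add: algebra_simps power2_eq_square power4_eq_xxxx)

lemma finite_measure_lebesgue_on_bounded_open: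
  assumes "open \<Omega>" "bounded (\<Omega> :: 'a::euclidean_space set)"
  shows "finite_measure (lebesgue_on \<Omega>)"
  using assms by (intro finite_measure_lebesgue_on) (simp add: lmeasurable_open)

text \<open>\<open>Fpot\<close> is not homogeneous, so scaling its argument needs an argument by
  monomials. The fourth power of \<open>f\<close> is recovered from \<open>Fpot\<close>, the square
  and a constant, all integrable on a set of finite measure; then the scaled polynomial is
  reassembled.\<close>

lemma integrable_Fpot_scale_cong_AE:
  assumes \<Omega>: "open \<Omega>" "bounded \<Omega>" and \<epsilon>: "\<epsilon> > 0" and L2: "L2 \<Omega> f"
    and F: "integrable (lebesgue_on \<Omega>) (\<lambda>x. Fpot \<epsilon> \<gamma> (f x))"
    and ae: "AE x in lebesgue_on \<Omega>. f' x = c * f x"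
  shows "integrable (lebesgue_on \<Omega>) (\<lambda>x. Fpot \<epsilon> \<gamma> (f' x))"
proof -
  interpret finite_measure "lebesgue_on \<Omega>"
    using \<Omega> by (rule finite_measure_lebesgue_on_bounded_open)
  define a b where "a = 1 / (4 * \<epsilon>\<^sup>2)" and "b = 1 / (2 * \<epsilon>\<^sup>2) + \<gamma> / 2"
  have F_eq: "Fpot \<epsilon> \<gamma> s = a - b * s\<^sup>2 + a * s ^ 4" for s
    using Fpot_expand[OF \<epsilon>] by (simp add: a_def b_def)
  have a: "a \<noteq> 0"
    using \<epsilon> by (simp add: a_def)
  have sq: "integrable (lebesgue_on \<Omega>) (\<lambda>x. (f x)\<^sup>2)"
    using L2 unfolding L2_def by simp
  have "integrable (lebesgue_on \<Omega>) (\<lambda>x. (Fpot \<epsilon> \<gamma> (f x) - a + b * (f x)\<^sup>2) / a)"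
    using F sq by simp
  then have quart: "integrable (lebesgue_on \<Omega>) (\<lambda>x. (f x) ^ 4)"
    using a by (simp add: F_eq)
  have "integrable (lebesgue_on \<Omega>) (\<lambda>x. a - b * c\<^sup>2 * (f x)\<^sup>2 + a * c ^ 4 * (f x) ^ 4)"
    using sq quart by (intro Bochner_Integration.integrable_add Bochner_Integration.integrable_diff integrable_mult_right) auto
  then show ?thesis
    by (rule integrable_lebesgue_on_cong_AE[rotated])
      (use ae in eventually_elim, simp add: F_eq power_mult_distrib, use \<Omega> in simp)
qed

lemma finite_energy_scale_cong_AE:
  assumes \<Omega>: "open \<Omega>" "bounded \<Omega>" and \<epsilon>: "\<epsilon> > 0" and fin: "finite_energy \<Omega> \<epsilon> \<gamma> \<phi> u"
    and ae: "AE x in lebesgue_on \<Omega>. \<phi>' x = c * \<phi> x" "AE x in lebesgue_on \<Omega>. u' x = c *\<^sub>R u x"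
  shows "finite_energy \<Omega> \<epsilon> \<gamma> \<phi>' u'"
proof -
  have "H1 \<Omega> \<phi>" "L2 \<Omega> u" and F: "integrable (lebesgue_on \<Omega>) (\<lambda>x. Fpot \<epsilon> \<gamma> (\<phi> x))"
    using fin by (simp_all add: finite_energy_def)
  then show ?thesis
    using H1_scale_cong_AE[OF \<Omega>(1) _ ae(1)] L2_scale_cong_AE[OF \<Omega>(1) _ ae(2)]
      integrable_Fpot_scale_cong_AE[OF \<Omega> \<epsilon> H1_imp_L2 F ae(1)]
    by (simp add: finite_energy_def)
qed

text \<open>This is the left-hand side of the bound by \<open>M\<^sub>T\<close>, and twice the part
  of the energy that is homogeneous of degree two.\<close>

definition quadratic_energy ::
    "(real^'d) set \<Rightarrow> real \<Rightarrow> real \<Rightarrow> (real^'d \<Rightarrow> real) \<Rightarrow> (real^'d \<Rightarrow> real^'d) \<Rightarrow> real" where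
  "quadratic_energy \<Omega> lam \<gamma> \<phi> u =
     (l2norm \<Omega> u)\<^sup>2 + lam * (l2norm \<Omega> (grad \<Omega> \<phi>))\<^sup>2 + lam * \<gamma> * (l2norm \<Omega> \<phi>)\<^sup>2"

lemma quadratic_energy_nonneg: "lam > 0 \<Longrightarrow> \<gamma> > 0 \<Longrightarrow> quadratic_energy \<Omega> lam \<gamma> \<phi> u \<ge> 0"
  unfolding quadratic_energy_def by simp

lemma quadratic_energy_scale_cong_AE:
  assumes \<Omega>: "open \<Omega>" and H1: "H1 \<Omega> \<phi>"
    and ae: "AE x in lebesgue_on \<Omega>. \<phi>' x = c * \<phi> x" "AE x in lebesgue_on \<Omega>. u' x = c *\<^sub>R u x"
  shows "quadratic_energy \<Omega> lam \<gamma> \<phi>' u' = c\<^sup>2 * quadratic_energy \<Omega> lam \<gamma> \<phi> u"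
  using l2norm_scale_cong_AE[OF \<Omega> ae(2)] l2norm_scale_cong_AE[OF \<Omega>, of \<phi>' c \<phi>] ae(1)
    l2norm_scale_cong_AE[OF \<Omega> grad_scale_cong_AE[OF \<Omega> H1 ae(1)]]
  unfolding quadratic_energy_def by (simp add: algebra_simps)

text \<open>Splitting the integral requires each summand to be integrable, which
  \<open>finite_energy\<close> guarantees.\<close>

lemma energy_eq_quadratic_energy:
  assumes \<Omega>: "open \<Omega>" and fin: "finite_energy \<Omega> \<epsilon> \<gamma> \<phi> u"
  shows "energy \<Omega> lam \<epsilon> \<gamma> \<phi> u =
    quadratic_energy \<Omega> lam \<gamma> \<phi> u / 2 + lam * (LINT x|lebesgue_on \<Omega>. Fpot \<epsilon> \<gamma> (\<phi> x))"
proof -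
  have H1: "H1 \<Omega> \<phi>" and "L2 \<Omega> u" and F: "integrable (lebesgue_on \<Omega>) (\<lambda>x. Fpot \<epsilon> \<gamma> (\<phi> x))"
    using fin by (simp_all add: finite_energy_def)
  then have "integrable (lebesgue_on \<Omega>) (\<lambda>x. (norm (u x))\<^sup>2)" "integrable (lebesgue_on \<Omega>) (\<lambda>x. (\<phi> x)\<^sup>2)"
    using H1_imp_L2[OF H1] by (simp_all add: L2_def)
  with H1_grad_integrable[OF \<Omega> H1] F show ?thesis
    unfolding energy_def quadratic_energy_def l2norm_power2 by (simp add: add_divide_distrib)
qed

text \<open>The assumption on \<open>\<kappa>0\<close> is positivity for each function separately.
  It becomes uniform because the infimum of the potential term is attained at a constant function,
  admissible since \<open>\<Omega>\<close> has finite measure; its value is the constant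
  \<open>c\<close>.\<close>

lemma energy_coercive:
  fixes \<Omega> :: "(real^'d) set"
  assumes \<Omega>: "open \<Omega>" "bounded \<Omega>" and pos: "lam > 0" "\<epsilon> > 0" "\<gamma> > 0"
    and bounded_below: "\<And>\<phi>. integrable (lebesgue_on \<Omega>) (\<lambda>x. Fpot \<epsilon> \<gamma> (\<phi> x)) \<Longrightarrow>
        lam * (LINT x|lebesgue_on \<Omega>. Fpot \<epsilon> \<gamma> (\<phi> x)) + \<kappa>0 > 0"
  obtains c where "c > 0"
    "\<forall>\<phi> u. finite_energy \<Omega> \<epsilon> \<gamma> \<phi> u \<longrightarrow>
      c + quadratic_energy \<Omega> lam \<gamma> \<phi> u / 2 \<le> energy \<Omega> lam \<epsilon> \<gamma> \<phi> u + \<kappa>0"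
proof
  interpret finite_measure "lebesgue_on \<Omega>"
    using \<Omega> by (rule finite_measure_lebesgue_on_bounded_open)
  let ?s = "sqrt (1 + \<gamma> * \<epsilon>\<^sup>2)"
  let ?c = "lam * (LINT x|lebesgue_on \<Omega>. Fpot \<epsilon> \<gamma> ?s) + \<kappa>0"
  have int: "integrable (lebesgue_on \<Omega>) (\<lambda>x. Fpot \<epsilon> \<gamma> ?s)"
    by simp
  show "?c > 0"
    by (rule bounded_below[OF int])
  show "\<forall>\<phi> u. finite_energy \<Omega> \<epsilon> \<gamma> \<phi> u \<longrightarrow>
      ?c + quadratic_energy \<Omega> lam \<gamma> \<phi> u / 2 \<le> energy \<Omega> lam \<epsilon> \<gamma> \<phi> u + \<kappa>0"
  proof (intro allI impI)
    fix \<phi> :: "real^'d \<Rightarrow> real" and u :: "real^'d \<Rightarrow> real^'d"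
    assume fin: "finite_energy \<Omega> \<epsilon> \<gamma> \<phi> u"
    have "(LINT x|lebesgue_on \<Omega>. Fpot \<epsilon> \<gamma> ?s) \<le> (LINT x|lebesgue_on \<Omega>. Fpot \<epsilon> \<gamma> (\<phi> x))"
    proof (rule integral_mono[OF int])
      show "Fpot \<epsilon> \<gamma> ?s \<le> Fpot \<epsilon> \<gamma> (\<phi> x)" for x
        using Fpot_complete_square[OF pos(2,3), of "\<phi> x"] by simp
    qed (use fin in \<open>simp add: finite_energy_def\<close>)
    then have "lam * (LINT x|lebesgue_on \<Omega>. Fpot \<epsilon> \<gamma> ?s) \<le> lam * (LINT x|lebesgue_on \<Omega>. Fpot \<epsilon> \<gamma> (\<phi> x))"
      using pos(1) by (intro mult_left_mono) auto
    then show "?c + quadratic_energy \<Omega> lam \<gamma> \<phi> u / 2 \<le> energy \<Omega> lam \<epsilon> \<gamma> \<phi> u + \<kappa>0"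
      using energy_eq_quadratic_energy[OF \<Omega>(1) fin, of lam] by simp
  qed
qed

subsection \<open>One step of the scheme\<close>

text \<open>The geometric sum formula extracts the factor \<open>\<xi>\<close> from
  \<open>1 - (1 - \<xi>) ^ m\<close>, where \<open>m\<close> is the exponent in \<open>eta\<close>
  (2 for \<open>k = 1\<close>). The remaining powers are controlled by the crude bound 1 +
  \<open>X\<close> on the absolute value of \<open>1 - \<xi>\<close>.\<close>

lemma abs_eta_le:
  assumes "0 \<le> \<xi>" "\<xi> \<le> X"
  shows "\<bar>eta k \<xi>\<bar> \<le> (\<Sum>i<(if k = 1 then 2 else k). (1 + X) ^ i) * \<xi>"
proof -
  define m where "m = (if k = 1 then 2 else k)"
  have "eta k \<xi> = 1 - (1 - \<xi>) ^ m"
    by (simp add: eta_def m_def)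
  then have "\<bar>eta k \<xi>\<bar> = \<xi> * \<bar>\<Sum>i<m. (1 - \<xi>) ^ i\<bar>"
    using assms(1) by (simp add: one_diff_power_eq abs_mult)
  also have "\<dots> \<le> \<xi> * (\<Sum>i<m. (1 + X) ^ i)"
  proof (intro mult_left_mono assms order_trans[OF sum_abs] sum_mono)
    show "\<bar>(1 - \<xi>) ^ i\<bar> \<le> (1 + X) ^ i" for i
      unfolding power_abs using assms by (intro power_mono) auto
  qed
  finally show ?thesis
    by (simp add: m_def mult.commute)
qed

text \<open>Eliminating \<open>r'\<close> turns the implicit update (S4) into the linear equation
  \<open>\<xi> * (e + dt * D) = r\<close>, whose coefficient is positive for every step
  size.\<close>

lemma relaxed_update_pos:
  fixes r r' dt D e \<xi> :: real
  assumes update: "(r' - r) / dt = - \<xi> * D" and \<xi>: "\<xi> = r' / e"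
    and pos: "dt > 0" "D \<ge> 0" "e > 0" "r > 0"
  shows "\<xi> > 0" "\<xi> * e \<le> r"
proof -
  have "r' = \<xi> * e"
    using \<xi> pos by simp
  then have eq: "\<xi> * e = r - dt * \<xi> * D"
    using update pos(1) by (simp add: field_simps)
  then have "\<xi> * (e + dt * D) = r"
    by (simp add: algebra_simps)
  moreover have "e + dt * D > 0"
    using pos by (simp add: add_pos_nonneg)
  ultimately show "\<xi> > 0"
    using pos(4) zero_less_mult_pos2 by metis
  with eq pos show "\<xi> * e \<le> r"
    by simp
qed

lemma chns_stepD:
  assumes "chns_step \<Omega> M lam \<nu> \<epsilon> \<gamma> \<kappa>0 k dt \<phi>t \<mu>t ut Rt \<xi> \<phi> \<mu> u p R n"
  shows "finite_energy \<Omega> \<epsilon> \<gamma> (\<phi>t (n+1)) (ut (n+1))"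
    "(Rt (n+1) - R n) / dt = - \<xi> (n+1) *
       (M * (l2norm \<Omega> (grad \<Omega> (\<mu>t (n+1))))\<^sup>2 + \<nu> * (l2norm \<Omega> (vgrad \<Omega> (bdf_B k u n)))\<^sup>2)"
    "\<xi> (n+1) = Rt (n+1) / (energy \<Omega> lam \<epsilon> \<gamma> (\<phi>t (n+1)) (ut (n+1)) + \<kappa>0)"
    "AE x in lebesgue_on \<Omega>. \<phi> (n+1) x = eta k (\<xi> (n+1)) * \<phi>t (n+1) x"
    "AE x in lebesgue_on \<Omega>. u (n+1) x = eta k (\<xi> (n+1)) *\<^sub>R ut (n+1) x"
    "R (n+1) = min (R n) (energy \<Omega> lam \<epsilon> \<gamma> (\<phi> (n+1)) (u (n+1)) + \<kappa>0)"
  using assms unfolding chns_step_def by - (elim conjE, assumption)+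

text \<open>The last bound is stated through an arbitrary upper bound \<open>r\<close> of
  \<open>R n\<close>, so that one value of \<open>r\<close> can serve all time levels and all step
  sizes.\<close>

lemma chns_step_bounds:
  fixes \<Omega> :: "(real^'d) set"
  assumes \<Omega>: "open \<Omega>" "bounded \<Omega>"
    and params: "M > 0" "lam > 0" "\<nu> > 0" "\<epsilon> > 0" "\<gamma> > 0" "dt > 0"
    and c: "c > 0" "\<forall>\<phi> u. finite_energy \<Omega> \<epsilon> \<gamma> \<phi> u \<longrightarrow>
      c + quadratic_energy \<Omega> lam \<gamma> \<phi> u / 2 \<le> energy \<Omega> lam \<epsilon> \<gamma> \<phi> u + \<kappa>0"
    and step: "chns_step \<Omega> M lam \<nu> \<epsilon> \<gamma> \<kappa>0 k dt \<phi>t \<mu>t ut Rt \<xi> \<phi> \<mu> u p R n"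
    and R: "R n > 0"
  shows "\<xi> (n+1) > 0" "0 < R (n+1)" "R (n+1) \<le> R n"
    "R n \<le> r \<Longrightarrow> quadratic_energy \<Omega> lam \<gamma> (\<phi> (n+1)) (u (n+1)) \<le>
        2 * (\<Sum>i<(if k = 1 then 2 else k). (1 + r / c) ^ i)\<^sup>2 * (r / c) * r"
proof -
  let ?e = "energy \<Omega> lam \<epsilon> \<gamma> (\<phi>t (n+1)) (ut (n+1)) + \<kappa>0"
  let ?q = "quadratic_energy \<Omega> lam \<gamma> (\<phi>t (n+1)) (ut (n+1))"
  have energy_pos: "energy \<Omega> lam \<epsilon> \<gamma> \<phi>' u' + \<kappa>0 > 0" if "finite_energy \<Omega> \<epsilon> \<gamma> \<phi>' u'" for \<phi>' u'
    using c(1) c(2)[rule_format, OF that] quadratic_energy_nonneg[OF params(2,5), of \<Omega> \<phi>' u'] by linarith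
  note S = chns_stepD[OF step]
  have e: "?e > 0" "c + ?q / 2 \<le> ?e"
    using energy_pos[OF S(1)] c(2)[rule_format, OF S(1)] by auto
  have q: "?q \<ge> 0"
    using quadratic_energy_nonneg[OF params(2,5)] .
  have D: "M * (l2norm \<Omega> (grad \<Omega> (\<mu>t (n+1))))\<^sup>2 + \<nu> * (l2norm \<Omega> (vgrad \<Omega> (bdf_B k u n)))\<^sup>2 \<ge> 0"
    using params by simp
  note \<xi> = relaxed_update_pos[OF S(2,3) params(6) D e(1) R]
  show "\<xi> (n+1) > 0"
    by (rule \<xi>(1))
  \<comment> \<open>Finite energy of the new functions makes the second argument of the minimum in
    (S7) positive.\<close>
  have "finite_energy \<Omega> \<epsilon> \<gamma> (\<phi> (n+1)) (u (n+1))"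
    by (rule finite_energy_scale_cong_AE[OF \<Omega> params(4) S(1,4,5)])
  then show "0 < R (n+1)" "R (n+1) \<le> R n"
    using energy_pos R S(6) by auto
  assume r: "R n \<le> r"
  define C where "C = (\<Sum>i<(if k = 1 then 2 else k). (1 + r / c) ^ i)"
  have "\<xi> (n+1) * c \<le> \<xi> (n+1) * ?e"
    using \<xi>(1) e(2) q by (intro mult_left_mono) auto
  then have \<xi>_le: "\<xi> (n+1) \<le> r / c"
    using \<xi>(2) r c(1) by (simp add: pos_le_divide_eq)
  have "\<bar>eta k (\<xi> (n+1))\<bar> \<le> C * \<xi> (n+1)"
    unfolding C_def using \<xi>(1) \<xi>_le by (intro abs_eta_le) auto
  then have "(eta k (\<xi> (n+1)))\<^sup>2 \<le> (C * \<xi> (n+1))\<^sup>2"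
    by (metis abs_ge_zero power2_abs power_mono)
  moreover have "?q \<le> 2 * ?e"
    using e(2) c(1) by simp
  ultimately have "(eta k (\<xi> (n+1)))\<^sup>2 * ?q \<le> (C * \<xi> (n+1))\<^sup>2 * (2 * ?e)"
    using q by (intro mult_mono) auto
  also have "\<dots> = 2 * C\<^sup>2 * (\<xi> (n+1) * (\<xi> (n+1) * ?e))"
    by (simp add: power2_eq_square algebra_simps)
  \<comment> \<open>One factor \<open>\<xi>\<close> absorbs the energy of the intermediate solution,
    which has no a priori bound, through \<open>\<xi> * e \<le> r\<close>; the other is at most
    \<open>r / c\<close>.\<close>
  also have "\<dots> \<le> 2 * C\<^sup>2 * (r / c * r)"
    using \<xi> \<xi>_le r e(1) by (intro mult_left_mono mult_mono) auto
  finally show "quadratic_energy \<Omega> lam \<gamma> (\<phi> (n+1)) (u (n+1)) \<le>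
        2 * (\<Sum>i<(if k = 1 then 2 else k). (1 + r / c) ^ i)\<^sup>2 * (r / c) * r"
    using quadratic_energy_scale_cong_AE[OF \<Omega>(1) _ S(4,5)] S(1)
    by (simp add: C_def finite_energy_def mult.assoc)
qed

section \<open>Propagation of the one-step estimates over all time levels\<close>

theorem theorem3p1:
  fixes \<Omega> :: "(real^'d) set"
    and M lam \<nu> \<epsilon> \<gamma> \<kappa>0 T :: real and k :: nat
    and \<phi>0 :: "real^'d \<Rightarrow> real" and u0 :: "real^'d \<Rightarrow> real^'d"
  assumes "CARD('d) = 2 \<or> CARD('d) = 3"
    and "open \<Omega>" and "connected \<Omega>" and "bounded \<Omega>" and "\<Omega> \<noteq> {}"
    and "M > 0" and "lam > 0" and "\<nu> > 0" and "\<epsilon> > 0" and "\<gamma> > 0" and "\<kappa>0 > 0"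
    and "\<And>\<phi>. integrable (lebesgue_on \<Omega>) (\<lambda>x. Fpot \<epsilon> \<gamma> (\<phi> x)) \<Longrightarrow>
               lam * (LINT x|lebesgue_on \<Omega>. Fpot \<epsilon> \<gamma> (\<phi> x)) + \<kappa>0 > 0"
    and "k \<in> {1, 2, 3, 4, 5}" and "T > 0"
  shows "(\<forall>dt > 0. \<forall>\<phi>t \<mu>t ut Rt \<xi> \<phi> \<mu> u p R.
            chns_scheme \<Omega> M lam \<nu> \<epsilon> \<gamma> \<kappa>0 k T dt \<phi>0 u0 \<phi>t \<mu>t ut Rt \<xi> \<phi> \<mu> u p R \<longrightarrow>
            (\<forall>n. k - 1 \<le> n \<and> real n \<le> T / dt \<longrightarrow>
               (R n > 0 \<longrightarrow> \<xi> (n+1) > 0 \<and> 0 < R (n+1) \<and> R (n+1) \<le> R n) \<and>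
               (energy \<Omega> lam \<epsilon> \<gamma> (\<phi> (n+1)) (u (n+1)) + \<kappa>0 \<le> R n \<longrightarrow>
                  energy \<Omega> lam \<epsilon> \<gamma> (\<phi> (n+1)) (u (n+1)) \<le> energy \<Omega> lam \<epsilon> \<gamma> (\<phi> n) (u n))))
       \<and> (\<exists>M\<^sub>T. \<forall>dt > 0. \<forall>\<phi>t \<mu>t ut Rt \<xi> \<phi> \<mu> u p R.
            chns_scheme \<Omega> M lam \<nu> \<epsilon> \<gamma> \<kappa>0 k T dt \<phi>0 u0 \<phi>t \<mu>t ut Rt \<xi> \<phi> \<mu> u p R \<longrightarrow>
            (\<forall>n. k - 1 \<le> n \<and> real n \<le> T / dt \<longrightarrow>
               (l2norm \<Omega> (u (n+1)))\<^sup>2 + lam * (l2norm \<Omega> (grad \<Omega> (\<phi> (n+1))))\<^sup>2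
                 + lam * \<gamma> * (l2norm \<Omega> (\<phi> (n+1)))\<^sup>2 \<le> M\<^sub>T))"
proof -
  obtain c where c: "c > 0"
    "\<forall>\<phi> u. finite_energy \<Omega> \<epsilon> \<gamma> \<phi> u \<longrightarrow>
      c + quadratic_energy \<Omega> lam \<gamma> \<phi> u / 2 \<le> energy \<Omega> lam \<epsilon> \<gamma> \<phi> u + \<kappa>0"
    using energy_coercive[OF assms(2,4,7,9,10,12)] by blast
  have k: "k \<ge> 1"
    using assms(13) by auto
  define r where "r = energy \<Omega> lam \<epsilon> \<gamma> \<phi>0 u0 + \<kappa>0"
  \<comment> \<open>Only \<open>k\<close>, the coercivity constant \<open>c\<close> and the initial
    value \<open>r\<close> of \<open>R\<close> enter, so this witness is fixed before
    \<open>dt\<close> and the solution are chosen.\<close>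
  let ?M = "2 * (\<Sum>i<(if k = 1 then 2 else k). (1 + r / c) ^ i)\<^sup>2 * (r / c) * r"
  have main: "R n > 0 \<Longrightarrow> \<xi> (n+1) > 0 \<and> 0 < R (n+1) \<and> R (n+1) \<le> R n"
    "energy \<Omega> lam \<epsilon> \<gamma> (\<phi> (n+1)) (u (n+1)) + \<kappa>0 \<le> R n \<Longrightarrow>
      energy \<Omega> lam \<epsilon> \<gamma> (\<phi> (n+1)) (u (n+1)) \<le> energy \<Omega> lam \<epsilon> \<gamma> (\<phi> n) (u n)"
    "quadratic_energy \<Omega> lam \<gamma> (\<phi> (n+1)) (u (n+1)) \<le> ?M"
    if dt: "dt > 0" and n: "k - 1 \<le> n" "real n \<le> T / dt"
      and scheme: "chns_scheme \<Omega> M lam \<nu> \<epsilon> \<gamma> \<kappa>0 k T dt \<phi>0 u0 \<phi>t \<mu>t ut Rt \<xi> \<phi> \<mu> u p R"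
    for dt \<phi>t \<mu>t ut Rt \<xi> \<phi> \<mu> u p R n
  proof -
    have step: "chns_step \<Omega> M lam \<nu> \<epsilon> \<gamma> \<kappa>0 k dt \<phi>t \<mu>t ut Rt \<xi> \<phi> \<mu> u p R m"
      if "k - 1 \<le> m" "real m \<le> T / dt" for m
      using scheme that unfolding chns_scheme_def by blast
    have start: "chns_start \<Omega> lam \<epsilon> \<gamma> \<kappa>0 k \<phi>0 u0 \<phi>t ut \<phi> \<mu> u p R"
      using scheme unfolding chns_scheme_def by blast
    have init: "\<phi> 0 = \<phi>0" "u 0 = u0" "R 0 = r"
      and start_fin: "\<And>j. j < k \<Longrightarrow> finite_energy \<Omega> \<epsilon> \<gamma> (\<phi> j) (u j)"
      and start_R: "\<And>j. j + 1 < k \<Longrightarrow> 0 < R (j+1) \<and> R (j+1) \<le> R j"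
      and start_energy: "\<And>j. j < k \<Longrightarrow> R j \<le> energy \<Omega> lam \<epsilon> \<gamma> (\<phi> j) (u j) + \<kappa>0"
      using start by (simp_all add: chns_start_def r_def)
    note bounds = chns_step_bounds[OF assms(2,4,6,7,8,9,10) dt c step]
    have "finite_energy \<Omega> \<epsilon> \<gamma> \<phi>0 u0"
      using start_fin[of 0] k init by simp
    then have "r > 0"
      using c quadratic_energy_nonneg[OF assms(7,10), of \<Omega> \<phi>0 u0] unfolding r_def by force
    \<comment> \<open>The range reaches \<open>T / dt + 1\<close> because the last admissible step
      starts at a level up to \<open>T / dt\<close> and produces the next one. The alternative
      \<open>m < k\<close> covers the starting values even when they lie beyond this range.\<close>
    have R: "0 < R m \<and> R m \<le> r" if "m < k \<or> real m \<le> T / dt + 1" for m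
      using that
    proof (induction m)
      case 0
      then show ?case
        using \<open>r > 0\<close> init by simp
    next
      case (Suc m)
      then have IH: "0 < R m" "R m \<le> r"
        by auto
      show ?case
      proof (cases "Suc m < k")
        case True
        then show ?thesis
          using start_R[of m] IH by auto
      next
        case False
        then have "k - 1 \<le> m" "real m \<le> T / dt"
          using Suc.prems by auto
        then show ?thesis
          using bounds(2,3)[of m] IH by auto
      qed
    qed
    show "R n > 0 \<Longrightarrow> \<xi> (n+1) > 0 \<and> 0 < R (n+1) \<and> R (n+1) \<le> R n"
      using bounds(1-3)[OF n] by blast
    show "quadratic_energy \<Omega> lam \<gamma> (\<phi> (n+1)) (u (n+1)) \<le> ?M"
      using bounds(4)[OF n] R[of n] n by simp
    \<comment> \<open>This closes the chain from the new energy through \<open>R n\<close> to the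
      old energy. It is an initialization condition for \<open>n < k\<close>, and otherwise the
      minimum in (S7) of the preceding step.\<close>
    have "R n \<le> energy \<Omega> lam \<epsilon> \<gamma> (\<phi> n) (u n) + \<kappa>0"
    proof (cases "n < k")
      case False
      define m where "m = n - 1"
      have m: "n = m + 1" "k - 1 \<le> m"
        using False k by (auto simp: m_def)
      then have "real m \<le> T / dt"
        using n by simp
      then show ?thesis
        using chns_stepD(6)[OF step[OF m(2)]] m(1) by simp
    qed (rule start_energy)
    then show "energy \<Omega> lam \<epsilon> \<gamma> (\<phi> (n+1)) (u (n+1)) + \<kappa>0 \<le> R n \<Longrightarrow>
      energy \<Omega> lam \<epsilon> \<gamma> (\<phi> (n+1)) (u (n+1)) \<le> energy \<Omega> lam \<epsilon> \<gamma> (\<phi> n) (u n)"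
      by linarith
  qed
  show ?thesis
    using main(1,2) main(3)[unfolded quadratic_energy_def]
    by (intro conjI exI[of _ ?M] allI impI; elim conjE) blast+
qed

end
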